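(* For every positive integer $n$ divisible by $6$, there exist an $n$-dimensional acyclic unique sink orientation (AUSO) $\psi$ of the hypercube $Q^n$, a starting vertex $v_0\in Q^n$, and a tie-breaking rule given by a fixed ordered list $T$ of the $2n$ directions, such that Zadeh's least-entered rule with tie-breaking list $T$, started at $v_0$, takes a path of length at least $2^{n/6}$ (i.e. makes at least $2^{n/6}$ steps) before reaching the global sink of $\psi$.
   Context: The $n$-dimensional hypercube $Q^n$ has vertex set $2^{[n]}$, with $u,v$ adjacent iff $|u\oplus v|=1$; the edge between $v$ and $v\oplus\{j\}$ is on coordinate $j$. A face is $F(C,v)=\{u: u\oplus v\subseteq C\}$. A unique sink orientation (USO) is an orientation of the edges of $Q^n$ such that every nonempty face has exactly one sink (vertex with no outgoing edges inside the face); an AUSO is an acyclic USO; the global sink is the unique vertex with no outgoing edges. A direction is a signed coordinate $\pm c$, $c\in[n]$; at $v$, $+c$ refers to the edge to $v\cup\{c\}$ ($c\notin v$) and $-c$ to the edge to $v\setminus\{c\}$ ($c\in v$); it is available at $v$ if that edge exists and is outgoing from $v$. Zadeh's least-entered rule: maintain for each of the $2n$ directions $d$ a count $h(d)$ of how many times $d$ has been used so far (initially all $0$). At each step, if the current vertex is not the global sink, among the available directions choose one minimizing $h(d)$; if several minimize $h$, choose the one appearing first in the fixed ordered list $T$; move along it and increment its count. *)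

theory Defs
  imports Main
begin

text \<open>Vertices of Q^n are subsets of [n] = {1..n}. An orientation is given by
  out v j, meaning: the edge of coordinate j at vertex v is outgoing from v.\<close>

type_synonym orientation = "nat set \<Rightarrow> nat \<Rightarrow> bool"

definition vertices :: "nat \<Rightarrow> nat set set" where
  "vertices n = Pow {1..n}"

definition sym_diff :: "nat set \<Rightarrow> nat set \<Rightarrow> nat set" where
  "sym_diff u v = (u - v) \<union> (v - u)"

definition is_orientation :: "nat \<Rightarrow> orientation \<Rightarrow> bool" where
  "is_orientation n out \<longleftrightarrow>
     (\<forall>v \<in> vertices n. \<forall>j \<in> {1..n}. out v j \<longleftrightarrow> \<not> out (sym_diff v {j}) j)"

definition face :: "nat \<Rightarrow> nat set \<Rightarrow> nat set \<Rightarrow> nat set set" where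
  "face n C v = {u \<in> vertices n. sym_diff u v \<subseteq> C}"

definition is_USO :: "nat \<Rightarrow> orientation \<Rightarrow> bool" where
  "is_USO n out \<longleftrightarrow> is_orientation n out \<and>
     (\<forall>C \<subseteq> {1..n}. \<forall>v \<in> vertices n.
        \<exists>!u. u \<in> face n C v \<and> (\<forall>j \<in> C. \<not> out u j))"

definition edge_rel :: "nat \<Rightarrow> orientation \<Rightarrow> (nat set \<times> nat set) set" where
  "edge_rel n out = {(u, sym_diff u {j}) | u j. u \<in> vertices n \<and> j \<in> {1..n} \<and> out u j}"

definition is_AUSO :: "nat \<Rightarrow> orientation \<Rightarrow> bool" where
  "is_AUSO n out \<longleftrightarrow> is_USO n out \<and> acyclic (edge_rel n out)"

definition is_global_sink :: "nat \<Rightarrow> orientation \<Rightarrow> nat set \<Rightarrow> bool" where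
  "is_global_sink n out v \<longleftrightarrow> v \<in> vertices n \<and> (\<forall>j \<in> {1..n}. \<not> out v j)"

text \<open>A direction is a signed coordinate (c, True) = +c, (c, False) = -c.\<close>
type_synonym direction = "nat \<times> bool"

definition directions :: "nat \<Rightarrow> direction set" where
  "directions n = {1..n} \<times> UNIV"

definition available :: "nat \<Rightarrow> orientation \<Rightarrow> nat set \<Rightarrow> direction \<Rightarrow> bool" where
  "available n out v d \<longleftrightarrow> fst d \<in> {1..n} \<and> (snd d \<longleftrightarrow> fst d \<notin> v) \<and> out v (fst d)"

definition move :: "nat set \<Rightarrow> direction \<Rightarrow> nat set" where
  "move v d = (if snd d then insert (fst d) v else v - {fst d})"

definition zadeh_step ::
  "nat \<Rightarrow> orientation \<Rightarrow> direction list \<Rightarrow> nat set \<times> (direction \<Rightarrow> nat)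
     \<Rightarrow> nat set \<times> (direction \<Rightarrow> nat)" where
  "zadeh_step n out T s =
     (let v = fst s; h = snd s;
          A = {d \<in> directions n. available n out v d}
      in if is_global_sink n out v \<or> A = {} then s
         else let m = Min (h ` A);
                  d = hd (filter (\<lambda>d. d \<in> A \<and> h d = m) T)
              in (move v d, h(d := Suc (h d))))"

definition zadeh_run ::
  "nat \<Rightarrow> orientation \<Rightarrow> direction list \<Rightarrow> nat set \<Rightarrow> nat
     \<Rightarrow> nat set \<times> (direction \<Rightarrow> nat)" where
  "zadeh_run n out T v0 k = (zadeh_step n out T ^^ k) (v0, \<lambda>_. 0)"

end

theory Submission
  imports Defs
begin

text \<open>The orientations are built by recursion, six dimensions at a time. The run on the
  \<open>n\<close>-cube goes from the empty set to the full set and uses every direction \<open>+c\<close> exactly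
  \<open>K + 1\<close> times and every direction \<open>-c\<close> exactly \<open>K\<close> times. A vertex of the \<open>(n + 6)\<close>-cube is a
  pair \<open>(U, X)\<close> with \<open>X \<subseteq> {1..6}\<close>. As long as \<open>card X \<le> 2\<close>, the coordinates of \<open>U\<close> are oriented
  as before; when \<open>card X = 3\<close> they all point towards the empty set; and when \<open>card X \<ge> 4\<close> they are
  oriented as before again. So the old run is performed, undone by \<open>n\<close> moves that equalise all
  counts, and performed a second time. The six new coordinates point upwards, except for a matching
  of reversed edges that depends on \<open>U\<close> and never joins two of the three ranges of \<open>card X\<close>; this
  is always a unique sink orientation. By varying the matching along the old run, \<open>X\<close> is made to
  travel on closed walks using all twelve new directions equally often, which keeps their counts
  balanced with the old ones. In particular the new directions leading out of the first range are
  never the least used ones before the old run has stopped.\<close>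

section \<open>Separated and ranked orientations\<close>

lemma sym_diff_iff: "x \<in> sym_diff u v \<longleftrightarrow> (x \<in> u) \<noteq> (x \<in> v)"
  by (auto simp: sym_diff_def)

text \<open>This is the Szabo-Welzl criterion for unique sink orientations. Being a condition on
  pairs of vertices, it is easier to carry through a product than one on faces.\<close>

definition separated :: "nat \<Rightarrow> orientation \<Rightarrow> bool" where
  "separated n out \<longleftrightarrow>
     (\<forall>u \<in> vertices n. \<forall>v \<in> vertices n. u \<noteq> v \<longrightarrow> (\<exists>j \<in> sym_diff u v. out u j \<noteq> out v j))"

text \<open>A numerical potential is kept instead of acyclicity because potentials of two factors
  can be combined lexicographically, as in \<open>ext_ranked\<close>.\<close>

definition ranked :: "nat \<Rightarrow> orientation \<Rightarrow> bool" where
  "ranked n out \<longleftrightarrow>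
     (\<exists>rank :: nat set \<Rightarrow> nat. \<forall>u \<in> vertices n. \<forall>j \<in> {1..n}.
        out u j \<longrightarrow> rank (sym_diff u {j}) < rank u)"

lemma separated_imp_orientation:
  assumes "separated n out"
  shows "is_orientation n out"
  unfolding is_orientation_def
proof (intro ballI)
  fix v j assume v: "v \<in> vertices n" and j: "j \<in> {1..n}"
  have *: "sym_diff v {j} \<in> vertices n"
    using v j by (auto simp: vertices_def sym_diff_def)
  have "v \<noteq> sym_diff v {j}"
    by (auto simp: set_eq_iff sym_diff_iff)
  then obtain i where "i \<in> sym_diff v (sym_diff v {j})" "out v i \<noteq> out (sym_diff v {j}) i"
    using assms v * unfolding separated_def by blast
  then show "out v j \<longleftrightarrow> \<not> out (sym_diff v {j}) j"
    by (auto simp: sym_diff_iff)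
qed

lemma face_eq:
  assumes "C \<subseteq> {1..n}" "v \<in> vertices n"
  shows "face n C v = sym_diff v ` Pow C"
proof -
  have "u \<in> sym_diff v ` Pow C" if "u \<in> face n C v" for u
  proof
    show "u = sym_diff v (sym_diff u v)" by (auto simp: sym_diff_iff)
    show "sym_diff u v \<in> Pow C" using that by (auto simp: face_def)
  qed
  moreover have "sym_diff v D \<in> face n C v" if "D \<subseteq> C" for D
    using that assms by (auto simp: face_def vertices_def sym_diff_def)
  ultimately show ?thesis by auto
qed

text \<open>On a face with coordinates \<open>C\<close> the outmap is an injection between two sets of size
  \<open>2 ^ card C\<close>, hence it attains the empty set exactly once.\<close>

lemma separated_imp_USO:
  assumes "separated n out"
  shows "is_USO n out"
  unfolding is_USO_def
proof (intro conjI allI impI ballI)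
  show "is_orientation n out" by (rule separated_imp_orientation[OF assms])
next
  fix C v assume C: "C \<subseteq> {1..n}" and v: "v \<in> vertices n"
  define F where "F = face n C v"
  define f where "f u = {j \<in> C. out u j}" for u
  have fin: "finite C" using C finite_subset by blast
  have inj_sd: "inj_on (sym_diff v) (Pow C)"
    by (rule inj_onI) (auto simp: set_eq_iff sym_diff_iff)
  have card_F: "card F = card (Pow C)"
    unfolding F_def face_eq[OF C v] by (rule card_image[OF inj_sd])
  have inj_f: "inj_on f F"
  proof (rule inj_onI, rule ccontr)
    fix x y assume x: "x \<in> F" and y: "y \<in> F" and eq: "f x = f y" and "x \<noteq> y"
    moreover have "x \<in> vertices n" "y \<in> vertices n" using x y by (auto simp: F_def face_def)
    ultimately obtain j where j: "j \<in> sym_diff x y" "out x j \<noteq> out y j"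
      using assms unfolding separated_def by blast
    have "sym_diff x v \<subseteq> C" "sym_diff y v \<subseteq> C" using x y by (auto simp: F_def face_def)
    then have "j \<in> C" using j(1) by (auto simp: sym_diff_iff subset_iff)
    then show False using eq j(2) by (auto simp: f_def set_eq_iff)
  qed
  have "f ` F = Pow C"
  proof (rule card_subset_eq)
    show "f ` F \<subseteq> Pow C" by (auto simp: f_def)
    show "card (f ` F) = card (Pow C)" by (simp add: card_image[OF inj_f] card_F)
  qed (use fin in simp)
  then obtain u where u: "u \<in> F" "f u = {}" by (metis (lifting) Pow_bottom imageE)
  have "\<forall>j\<in>C. \<not> out u j" using u(2) by (auto simp: f_def)
  moreover have "u' = u" if "u' \<in> F" "\<forall>j\<in>C. \<not> out u' j" for u'
  proof -
    have "f u' = f u" using that(2) u(2) by (auto simp: f_def)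
    then show ?thesis using inj_f that(1) u(1) by (simp add: inj_on_def)
  qed
  ultimately show "\<exists>!u. u \<in> face n C v \<and> (\<forall>j\<in>C. \<not> out u j)"
    using u(1) unfolding F_def by blast
qed

lemma ranked_imp_acyclic:
  assumes "ranked n out"
  shows "acyclic (edge_rel n out)"
proof -
  obtain rank :: "nat set \<Rightarrow> nat" where
    rank: "\<forall>u \<in> vertices n. \<forall>j \<in> {1..n}. out u j \<longrightarrow> rank (sym_diff u {j}) < rank u"
    using assms unfolding ranked_def by blast
  have "edge_rel n out \<subseteq> (measure rank)\<inverse>"
    using rank by (auto simp: edge_rel_def)
  moreover have "acyclic ((measure rank)\<inverse>)"
    by (simp add: acyclic_converse wf_acyclic)
  ultimately show ?thesis by (rule acyclic_subset[rotated])
qed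

section \<open>Runs of Zadeh's rule\<close>

text \<open>The relation is reflexive on purpose: a minimiser is also compared with itself in
  \<open>zbest\<close>. With \<open>takeWhile\<close> it behaves well under appending lists.\<close>

definition before :: "direction list \<Rightarrow> direction \<Rightarrow> direction \<Rightarrow> bool" where
  "before T d e \<longleftrightarrow> e \<notin> set (takeWhile (\<lambda>x. x \<noteq> d) T)"

text \<open>This is the choice of \<open>zadeh_step\<close> written as pairwise comparisons, so that
  old and new directions can be treated separately.\<close>

definition zbest ::
  "nat \<Rightarrow> orientation \<Rightarrow> direction list \<Rightarrow> nat set \<Rightarrow> (direction \<Rightarrow> nat) \<Rightarrow> direction \<Rightarrow> bool" where
  "zbest n out T v h d \<longleftrightarrow> available n out v d \<and>
     (\<forall>e. available n out v e \<longrightarrow> h d < h e \<or> h d = h e \<and> before T d e)"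

lemma available_directions: "available n out v d \<Longrightarrow> d \<in> directions n"
  by (cases d) (auto simp: available_def directions_def)

lemma finite_directions: "finite (directions n)"
  by (simp add: directions_def)

lemma hd_filter_eq:
  assumes "d \<in> set T" "P d" "\<And>e. P e \<Longrightarrow> before T d e"
  shows "hd (filter P T) = d"
  using assms
proof (induction T)
  case (Cons a T)
  show ?case
  proof (cases "a = d")
    case False
    then have "\<not> P a" using Cons.prems(3)[of a] by (auto simp: before_def)
    moreover have "hd (filter P T) = d"
      using Cons.prems False by (intro Cons.IH) (auto simp: before_def)
    ultimately show ?thesis by simp
  qed (use Cons.prems in simp)
qed simp

lemma before_hd_filter:
  assumes "d = hd (filter P T)" "e \<in> set T" "P e"
  shows "before T d e"
  using assms
proof (induction T)
  case (Cons a T)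
  show ?case
  proof (cases "P a")
    case True
    then show ?thesis using Cons.prems by (simp add: before_def)
  next
    case False
    then have "before T d e" using Cons by auto
    moreover have "a \<noteq> e" using False Cons.prems by auto
    ultimately show ?thesis by (auto simp: before_def)
  qed
qed simp

lemma zadeh_step_eq:
  assumes "zbest n out T v h d" "set T = directions n"
  shows "zadeh_step n out T (v, h) = (move v d, h(d := Suc (h d)))"
proof -
  let ?A = "{d \<in> directions n. available n out v d}"
  have av: "available n out v d" using assms(1) by (simp add: zbest_def)
  then have d: "d \<in> ?A" using available_directions by simp
  have ns: "\<not> is_global_sink n out v"
    using av by (auto simp: is_global_sink_def available_def)
  have m: "Min (h ` ?A) = h d"
  proof (rule Min_eqI)
    show "h d \<le> y" if "y \<in> h ` ?A" for y
      using that assms(1) by (force simp: zbest_def)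
  qed (use d finite_directions in auto)
  have "hd (filter (\<lambda>e. e \<in> ?A \<and> h e = h d) T) = d"
  proof (rule hd_filter_eq)
    show "before T d e" if e: "e \<in> ?A \<and> h e = h d" for e
    proof -
      have "h d < h e \<or> h d = h e \<and> before T d e"
        using e assms(1) unfolding zbest_def by blast
      then show ?thesis using e by simp
    qed
  qed (use d assms(2) in auto)
  moreover have "?A \<noteq> {}" using d by blast
  ultimately show ?thesis
    using ns m by (simp only: zadeh_step_def Let_def fst_conv snd_conv if_False simp_thms)
qed

lemma zbest_le:
  assumes "zbest n out T v h d" "available n out v e"
  shows "h d \<le> h e"
proof -
  have "h d < h e \<or> h d = h e \<and> before T d e" using assms unfolding zbest_def by blast
  then show ?thesis by auto
qed

lemma move_subset: "v \<subseteq> {1..n} \<Longrightarrow> d \<in> directions n \<Longrightarrow> move v d \<subseteq> {1..n}"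
  by (auto simp: move_def directions_def mem_Times_iff)

text \<open>Serves \<open>return_run\<close>, where the chosen direction is not computed but only
  shown to be of the right kind.\<close>

lemma zbest_exists:
  assumes "available n out v e" "set T = directions n"
  shows "\<exists>d. zbest n out T v h d"
proof -
  let ?A = "{d \<in> directions n. available n out v d}"
  let ?m = "Min (h ` ?A)"
  let ?P = "\<lambda>d. d \<in> ?A \<and> h d = ?m"
  let ?d = "hd (filter ?P T)"
  have fin: "finite (h ` ?A)" using finite_directions by simp
  have ne: "h ` ?A \<noteq> {}" using assms(1) available_directions by blast
  have "?m \<in> h ` ?A" by (rule Min_in[OF fin ne])
  then have "filter ?P T \<noteq> []" using assms(2) by (force simp: filter_empty_conv)
  then have d: "?P ?d" using hd_in_set by fastforce
  have "h ?d < h e \<or> h ?d = h e \<and> before T ?d e" if "available n out v e" for e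
  proof (cases "h e = ?m")
    case True
    have "e \<in> directions n" using that by (rule available_directions)
    then have "before T ?d e"
      using True that assms(2) by (intro before_hd_filter[of _ ?P]) auto
    then show ?thesis using True d by simp
  next
    case False
    have "?m \<le> h e" using that available_directions fin by (intro Min_le) auto
    then show ?thesis using False d by simp
  qed
  then show ?thesis using d unfolding zbest_def by blast
qed

type_synonym zstate = "nat \<times> nat set \<times> (direction \<Rightarrow> nat)"

text \<open>A state carries, besides the vertex and the history, the phase of the run so far. A run
  enters phase \<open>2 * j + 1\<close>, and later phase \<open>2 * j + 2\<close>, by moves in directions that were used
  exactly \<open>j\<close> times before, and up to the end of phase \<open>2 * j + 2\<close> no direction that was used more
  than \<open>j\<close> times is chosen. The phase is a function \<open>\<phi>\<close> of the vertex, so that the orientation of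
  the larger cube may depend on it.\<close>

definition zphase_step ::
  "nat \<Rightarrow> orientation \<Rightarrow> direction list \<Rightarrow> (nat set \<Rightarrow> nat) \<Rightarrow> zstate \<Rightarrow> zstate \<Rightarrow> bool" where
  "zphase_step n out T \<phi> = (\<lambda>(r, v, h) (r', v', h'). \<exists>d. zbest n out T v h d \<and> r' = \<phi> v \<and>
     2 * h d + 1 \<le> r' \<and> (r' = r \<or> r' = Suc r \<and> h d = r div 2) \<and>
     v' = move v d \<and> h' = h(d := Suc (h d)))"

lemma zphase_stepI:
  assumes "zbest n out T v h d" "\<phi> v = r'" "2 * h d + 1 \<le> r'"
    "r' = r \<or> r' = Suc r \<and> h d = r div 2"
  shows "zphase_step n out T \<phi> (r, v, h) (r', move v d, h(d := Suc (h d)))"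
  using assms unfolding zphase_step_def prod.case by blast

lemma zphase_stepE:
  assumes "zphase_step n out T \<phi> (r, v, h) (r', v', h')"
  obtains d where "zbest n out T v h d" "r' = \<phi> v" "2 * h d + 1 \<le> r'"
    "r' = r \<or> r' = Suc r \<and> h d = r div 2" "v' = move v d" "h' = h(d := Suc (h d))"
  using assms unfolding zphase_step_def prod.case by blast

lemma zphase_run_zadeh:
  assumes "(zphase_step n out T \<phi> ^^ k) (r, v, h) (r', v', h')" "set T = directions n"
  shows "(zadeh_step n out T ^^ k) (v, h) = (v', h')"
  using assms(1)
proof (induction k arbitrary: r' v' h')
  case (Suc k)
  then obtain r1 v1 h1 where 1: "(zphase_step n out T \<phi> ^^ k) (r, v, h) (r1, v1, h1)"
    "zphase_step n out T \<phi> (r1, v1, h1) (r', v', h')"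
    by (auto elim!: relcomppE)
  have "zadeh_step n out T (v1, h1) = (v', h')"
    using 1(2) zadeh_step_eq[OF _ assms(2)] by (auto simp: zphase_step_def)
  then show ?case using Suc.IH[OF 1(1)] by simp
qed simp

text \<open>The vertex after \<open>k\<close> steps is left by a further step of the run, so it has
  an outgoing edge.\<close>

lemma zphase_run_not_sink:
  assumes "(zphase_step n out T \<phi> ^^ l) (r, v, \<lambda>_. 0) s" "k < l" "set T = directions n"
  shows "\<not> is_global_sink n out (fst (zadeh_run n out T v k))"
proof -
  obtain i where "l = k + Suc i" using less_imp_Suc_add[OF assms(2)] by auto
  then have "((zphase_step n out T \<phi> ^^ k) OO (zphase_step n out T \<phi> ^^ Suc i)) (r, v, \<lambda>_. 0) s"
    using assms(1) by (simp only: relpowp_add)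
  then obtain r1 v1 h1 where 1: "(zphase_step n out T \<phi> ^^ k) (r, v, \<lambda>_. 0) (r1, v1, h1)"
    and 2: "(zphase_step n out T \<phi> ^^ Suc i) (r1, v1, h1) s" by (auto elim!: relcomppE)
  from 2 obtain s' where "zphase_step n out T \<phi> (r1, v1, h1) s'"
    by (rule relpowp_E2) auto
  then obtain d where "available n out v1 d"
    by (cases s') (auto simp: zphase_step_def zbest_def)
  then have "\<not> is_global_sink n out v1" by (auto simp: is_global_sink_def available_def)
  then show ?thesis
    using zphase_run_zadeh[OF 1 assms(3)] by (simp add: zadeh_run_def)
qed

section \<open>The gadget on six coordinates\<close>

text \<open>\<open>flipped p q Y i\<close> says that the edge from \<open>Y\<close> to \<open>insert i Y\<close> is reversed. The flag \<open>p\<close>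
  governs the sets of size at most two, \<open>q\<close> those of size at least four. With \<open>p\<close> the least-used walk
  leads from \<open>{}\<close> via \<open>{1}\<close>, \<open>{1,2}\<close>, \<open>{2}\<close>, \<open>{2,3}\<close>, ... to \<open>{6}\<close>, and without \<open>p\<close> from \<open>{6}\<close> back to
  \<open>{}\<close>; in the complements, \<open>q\<close> leads from \<open>{}\<close> to \<open>{1}\<close> and its negation from \<open>{1}\<close> via \<open>{1,2}\<close>,
  \<open>{2}\<close>, ..., \<open>{6}\<close> to \<open>{}\<close>.\<close>

definition flipped :: "bool \<Rightarrow> bool \<Rightarrow> nat set \<Rightarrow> nat \<Rightarrow> bool" where
  "flipped p q Y i \<longleftrightarrow>
     p \<and> i \<in> {1,2,3,4,5} \<and> Y = {Suc i} \<or>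
     \<not> p \<and> i = 6 \<and> Y = {} \<or>
     q \<and> i = 1 \<and> Y = {2,3,4,5,6} \<or>
     \<not> q \<and> i \<in> {2,3,4,5,6} \<and> Y = {1,2,3,4,5,6} - {i - 1, i}"

definition gadget :: "bool \<Rightarrow> bool \<Rightarrow> nat set \<Rightarrow> nat \<Rightarrow> bool" where
  "gadget p q X i \<longleftrightarrow> (i \<notin> X) \<noteq> flipped p q (X - {i}) i"

text \<open>Negative directions come first, so at equal counts a reversed edge is preferred to a
  further ascent. In \<open>walk_up_low\<close> this makes \<open>{1,2}\<close> descend to
  \<open>{2}\<close>.\<close>

definition order6 :: "direction list" where
  "order6 = map (\<lambda>i. (i, False)) [1,2,3,4,5,6] @ map (\<lambda>i. (i, True)) [1,2,3,4,5,6]"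

definition gadget_available :: "bool \<Rightarrow> bool \<Rightarrow> nat set \<Rightarrow> direction \<Rightarrow> bool" where
  "gadget_available p q X d \<longleftrightarrow> (snd d \<longleftrightarrow> fst d \<notin> X) \<and> gadget p q X (fst d)"

text \<open>The numbering decreases with the cardinality: reversed edges stay in a level and all
  others point upwards, so outgoing edges never raise it.\<close>

definition level :: "nat set \<Rightarrow> nat" where
  "level X = (if card X \<le> 2 then 2 else if card X = 3 then 1 else 0)"

text \<open>Only edges inside one level have to decrease this number. The consecutive values 12 to 2
  follow the zigzag \<open>{1}\<close>, \<open>{1,2}\<close>, \<open>{2}\<close>, ...,
  \<open>{6}\<close>, taken in complements in the top range.\<close>

definition gadget_rank :: "bool \<Rightarrow> bool \<Rightarrow> nat set \<Rightarrow> nat" where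
  "gadget_rank p q X =
    (if card X \<le> 2 then
       (if p then
          (if X = {} then 20 else if X = {1} then 12 else if X = {1,2} then 11
           else if X = {2} then 10 else if X = {2,3} then 9 else if X = {3} then 8
           else if X = {3,4} then 7 else if X = {4} then 6 else if X = {4,5} then 5
           else if X = {5} then 4 else if X = {5,6} then 3 else if X = {6} then 2 else 0)
        else (if X = {6} then 3 else 2 - card X))
     else if card X = 3 then 0
     else
       (if q then (if X = {2,3,4,5,6} then 0 else 7 - card X)
        else
         (let Y = {1,2,3,4,5,6} - X in
            if Y = {} then 0 else if Y = {1} then 12 else if Y = {1,2} then 11
            else if Y = {2} then 10 else if Y = {2,3} then 9 else if Y = {3} then 8
            else if Y = {3,4} then 7 else if Y = {4} then 6 else if Y = {4,5} then 5
            else if Y = {5} then 4 else if Y = {5,6} then 3 else if Y = {6} then 2 else 20)))"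

text \<open>A finite check of everything needed about the gadget: reversed edges form a matching
  inside the levels, and outgoing edges lower the pair of \<open>level\<close> and
  \<open>gadget_rank\<close> lexicographically. All quantifiers range over explicit finite sets, so
  evaluation decides it.\<close>

lemma gadget_table:
  "\<forall>p \<in> {True, False}. \<forall>q \<in> {True, False}. \<forall>X \<in> Pow {1,2,3,4,5,6}. \<forall>i \<in> {1,2,3,4,5,6}.
     (flipped p q (X - {i}) i \<longrightarrow> level (X - {i}) = level (insert i X) \<and>
        (\<forall>j \<in> {1,2,3,4,5,6}. flipped p q (X - {j}) j \<longrightarrow> j = i)) \<and>
     (gadget p q X i \<longrightarrow> level (sym_diff X {i}) < level X \<or>
        level (sym_diff X {i}) = level X \<and> gadget_rank p q (sym_diff X {i}) < gadget_rank p q X)"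
  by code_simp

lemma gadget_table_entry:
  assumes "X \<subseteq> {1..6}" "i \<in> {1..6}"
  shows "(flipped p q (X - {i}) i \<longrightarrow> level (X - {i}) = level (insert i X) \<and>
        (\<forall>j \<in> {1..6}. flipped p q (X - {j}) j \<longrightarrow> j = i)) \<and>
     (gadget p q X i \<longrightarrow> level (sym_diff X {i}) < level X \<or>
        level (sym_diff X {i}) = level X \<and> gadget_rank p q (sym_diff X {i}) < gadget_rank p q X)"
proof -
  have *: "{1..6} = {1,2,3,4,5,6::nat}" by auto
  show ?thesis
    using assms unfolding *
    by (intro bspec[OF bspec[OF bspec[OF bspec[OF gadget_table, of p], of q], of X], of i]) auto
qed

lemma mem_order6: "d \<in> set order6 \<longleftrightarrow> fst d \<in> {1,2,3,4,5,6}"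
  by (cases d; cases "snd d") (auto simp: order6_def)

lemma flipped_unique:
  assumes "X \<subseteq> {1..6}" "i \<in> {1..6}" "j \<in> {1..6}" "flipped p q (X - {i}) i" "flipped p q (X - {j}) j"
  shows "i = j"
  using gadget_table_entry[of X i p q] assms by blast

lemma flipped_level:
  assumes "X \<subseteq> {1..6}" "i \<in> {1..6}" "flipped p q (X - {i}) i"
  shows "level (sym_diff X {i}) = level X"
proof -
  have "level (X - {i}) = level (insert i X)"
    using gadget_table_entry[of X i p q] assms by blast
  moreover have "sym_diff X {i} = (if i \<in> X then X - {i} else insert i X)"
    by (auto simp: sym_diff_def)
  ultimately show ?thesis by (cases "i \<in> X") (simp_all add: insert_absorb)
qed

lemma gadget_edge:
  assumes "X \<subseteq> {1..6}" "i \<in> {1..6}" "gadget p q X i"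
  shows "level (sym_diff X {i}) < level X \<or>
    level (sym_diff X {i}) = level X \<and> gadget_rank p q (sym_diff X {i}) < gadget_rank p q X"
  using gadget_table_entry[of X i p q] assms by blast

text \<open>In the uniform orientation \<open>X\<close> and \<open>Y\<close> disagree on every coordinate of their difference, and
  each of them has at most one reversed edge. So only differences of size one or two matter, where
  a failure would force two reversed edges at a common vertex or a reversed edge between two
  levels.\<close>

lemma gadget_separated:
  assumes X: "X \<subseteq> {1..6}" and Y: "Y \<subseteq> {1..6}" and "X \<noteq> Y"
    and pq: "p = p' \<and> q = q' \<or> level X \<noteq> level Y"
  shows "\<exists>i \<in> sym_diff X Y. gadget p q X i \<noteq> gadget p' q' Y i"
proof (rule ccontr)
  assume contr: "\<not> ?thesis"
  \<comment> \<open>On the difference of \<open>X\<close> and \<open>Y\<close> exactly one of the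
    two edges at each coordinate is reversed. \<open>key\<close> refutes the case of a reversed edge
    at the first set; the other case follows by exchanging the roles.\<close>
  have key: False
    if X: "X \<subseteq> {1..6}" and Y: "Y \<subseteq> {1..6}"
      and pq: "p = p' \<and> q = q' \<or> level X \<noteq> level Y"
      and one: "\<And>i. i \<in> sym_diff X Y \<Longrightarrow>
        flipped p q (X - {i}) i \<noteq> flipped p' q' (Y - {i}) i"
      and i: "i \<in> sym_diff X Y" "flipped p q (X - {i}) i"
    for X Y p q p' q' i
  proof -
    have sub: "sym_diff X Y \<subseteq> {1..6}" using X Y by (auto simp: sym_diff_def)
    have lX: "level (sym_diff X {i}) = level X" using flipped_level[OF X _ i(2)] i(1) sub by auto
    show False
    proof (cases "sym_diff X Y = {i}")
      case True
      then have Y_eq: "Y = sym_diff X {i}" by (auto simp: set_eq_iff sym_diff_iff)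
      then have "Y - {i} = X - {i}" by (auto simp: sym_diff_iff)
      then show False using one[OF i(1)] i(2) pq lX Y_eq by auto
    next
      case False
      then obtain j where j: "j \<in> sym_diff X Y" "j \<noteq> i" using i(1) by auto
      have uniq: "\<not> flipped p q (X - {k}) k" if "k \<in> sym_diff X Y" "k \<noteq> i" for k
        using flipped_unique[OF X _ _ i(2)] that i(1) sub by blast
      have fj: "flipped p' q' (Y - {j}) j" using one[OF j(1)] uniq[OF j] by simp
      have "k = i \<or> k = j" if "k \<in> sym_diff X Y" for k
        using one[OF that] uniq[OF that] flipped_unique[OF Y _ _ fj] that j(1) sub by blast
      \<comment> \<open>Here the difference is exactly \<open>{i, j}\<close>, so the reversed edge
        at \<open>X\<close> and the one at \<open>Y\<close> end in the same vertex. This contradicts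
        the matching property once the flags are known to coincide.\<close>
      then have Z: "sym_diff X {i} = sym_diff Y {j}"
        using i(1) j by (auto simp: set_eq_iff sym_diff_iff)
      have "level (sym_diff Y {j}) = level Y" using flipped_level[OF Y _ fj] j(1) sub by auto
      then have same: "p = p'" "q = q'" using pq lX Z by auto
      have "sym_diff X {i} - {i} = X - {i}" by (auto simp: sym_diff_iff)
      then have "flipped p q (sym_diff X {i} - {i}) i" using i(2) by simp
      moreover have "sym_diff X {i} - {j} = Y - {j}" unfolding Z by (auto simp: sym_diff_iff)
      then have "flipped p q (sym_diff X {i} - {j}) j" using fj same by simp
      moreover have "sym_diff X {i} \<subseteq> {1..6}" using X i(1) sub by (auto simp: sym_diff_def)
      moreover have "i \<in> {1..6}" "j \<in> {1..6}" using i(1) j(1) sub by blast+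
      ultimately have "i = j" by (metis flipped_unique)
      then show False using j(2) by simp
    qed
  qed
  have one: "flipped p q (X - {i}) i \<noteq> flipped p' q' (Y - {i}) i" if "i \<in> sym_diff X Y" for i
    using contr that by (auto simp: gadget_def sym_diff_iff)
  obtain i where i: "i \<in> sym_diff X Y" using \<open>X \<noteq> Y\<close> by (auto simp: sym_diff_def)
  have comm: "sym_diff Y X = sym_diff X Y" by (auto simp: sym_diff_def)
  show False
  proof (cases "flipped p q (X - {i}) i")
    case True
    then show False using key[OF X Y pq one i] by simp
  next
    case False
    then have "flipped p' q' (Y - {i}) i" using one[OF i] by simp
    moreover have "p' = p \<and> q' = q \<or> level Y \<noteq> level X" using pq by auto
    moreover have "flipped p' q' (Y - {i}) i \<noteq> flipped p q (X - {i}) i" if "i \<in> sym_diff Y X" for i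
      using one[of i] that comm by auto
    ultimately show False using key[OF Y X, of p' p q' q i] i comm by simp
  qed
qed

lemma gadget_rank_le: "gadget_rank p q X \<le> 20"
proof -
  have *: "(if b then x else y) \<le> 20" if "x \<le> 20" "y \<le> 20" for b and x y :: nat
    using that by simp
  then show ?thesis unfolding gadget_rank_def Let_def by (intro *) auto
qed

text \<open>\<open>walk lv p q f b s' s ds\<close>: the moves \<open>ds\<close>, all made at level \<open>lv\<close> and in directions used at most
  \<open>b\<close> times, are the choices of Zadeh's rule within the gadget and lead from \<open>s\<close> to \<open>s'\<close>. Counts and
  phases are relative to offsets \<open>j\<close> and \<open>2 * j\<close>, so that for concrete moves this is a
  computation.\<close>

fun walk :: "nat \<Rightarrow> bool \<Rightarrow> bool \<Rightarrow> (nat set \<Rightarrow> nat) \<Rightarrow> nat \<Rightarrow> zstate \<Rightarrow> zstate \<Rightarrow> direction list \<Rightarrow> bool"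
  where
  "walk lv p q f b s (r, X, c) [] \<longleftrightarrow>
     r = fst s \<and> X = fst (snd s) \<and> (\<forall>d \<in> set order6. c d = snd (snd s) d)"
| "walk lv p q f b s (r, X, c) (d # ds) \<longleftrightarrow>
     d \<in> set order6 \<and> gadget_available p q X d \<and> level X = lv \<and>
     (\<forall>e \<in> set order6. gadget_available p q X e \<longrightarrow> c d < c e \<or> c d = c e \<and> before order6 d e) \<and>
     c d \<le> b \<and> 2 * c d + 1 \<le> f X \<and> (f X = r \<or> f X = Suc r \<and> c d = r div 2) \<and>
     walk lv p q f b s (f X, move X d, c(d := Suc (c d))) ds"

declare walk.simps [simp del]

text \<open>This walk is made when the old run enters an odd phase, and \<open>walk_down_low\<close>
  when it enters the next even one. The first uses all new directions except
  \<open>(6, False)\<close> once and the second supplies that one, so a round raises all twelve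
  counts by one.\<close>

lemma walk_up_low:
  "\<forall>q \<in> {True, False}. walk 2 True q (\<lambda>X. if X = {} then 1 else 2) 0
     (2, {6}, \<lambda>d. if d = (6, False) then 0 else 1) (0, {}, \<lambda>_. 0)
     [(1,True), (2,True), (1,False), (3,True), (2,False), (4,True), (3,False),
      (5,True), (4,False), (6,True), (5,False)]"
  by code_simp

lemma walk_down_low:
  "\<forall>q \<in> {True, False}. walk 2 False q (\<lambda>X. 2) 0
     (2, {}, \<lambda>d. 1) (2, {6}, \<lambda>d. if d = (6, False) then 0 else 1) [(6,False)]"
  by code_simp

text \<open>Made at the old sink: without the zigzag of reversed edges, \<open>X\<close> climbs
  straight to three elements, where the old coordinates turn round.\<close>

lemma walk_exit:
  "walk 2 False False (\<lambda>X. if X = {} then 1 else 2) 0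
     (2, {1,2,3}, \<lambda>d. if snd d \<and> fst d \<le> 3 then 1 else 0) (0, {}, \<lambda>_. 0)
     [(1,True), (2,True), (3,True)]"
  by code_simp

lemma walk_enter:
  "walk 0 True False (\<lambda>X. 2) 0
     (2, {1,2,3,4,5,6}, \<lambda>d. if snd d then 1 else 0)
     (2, {1,2,3,4}, \<lambda>d. if snd d \<and> fst d \<le> 4 then 1 else 0)
     [(5,True), (6,True)]"
  by code_simp

text \<open>Level 1 is outside the scope of \<open>walk_run\<close>; \<open>enter_run\<close> only
  extracts from this computation that \<open>(4, True)\<close> is the best new direction.\<close>

lemma walk_enter_first:
  "walk 1 True False (\<lambda>X. 2) 0
     (2, {1,2,3,4}, \<lambda>d. if snd d \<and> fst d \<le> 4 then 1 else 0)
     (2, {1,2,3}, \<lambda>d. if snd d \<and> fst d \<le> 3 then 1 else 0) [(4,True)]"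
  by code_simp

text \<open>Together with \<open>walk_up_high\<close> this closes a cycle through all twelve
  directions in the top range. The positive counts start one ahead because the ascent to the full
  set has used each positive direction once more.\<close>

lemma walk_down_high:
  "walk 0 True True (\<lambda>X. if X = {2,3,4,5,6} then 3 else 2) 1
     (2, {2,3,4,5,6}, \<lambda>d. if snd d \<or> d = (1, False) then 1 else 0)
     (2, {1,2,3,4,5,6}, \<lambda>d. if snd d then 1 else 0)
     [(1,False)]"
  by code_simp

lemma walk_up_high:
  "walk 0 False False (\<lambda>X. if X = {1,2,3,4,5,6} then 4 else 3) 1
     (3, {1,2,3,4,5,6}, \<lambda>d. if snd d then 2 else 1)
     (3, {2,3,4,5,6}, \<lambda>d. if snd d \<or> d = (1, False) then 1 else 0)
     [(2,False), (1,True), (3,False), (2,True), (4,False), (3,True), (5,False),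
      (4,True), (6,False), (5,True), (6,True)]"
  by code_simp

text \<open>In an odd phase \<open>(6, False)\<close> is the one new direction whose count lags
  behind. Its unavailability at the resting place \<open>{6}\<close> keeps it from interrupting the
  old run.\<close>

lemma low_rest_unavailable: "\<not> gadget_available True q {6} (6, False)"
  by (simp add: gadget_available_def gadget_def flipped_def)

text \<open>The resting places in the top range are sinks of the gadget, so there the old run
  proceeds whatever the new counts are.\<close>

lemma high_rest_unavailable:
  assumes "d \<in> set order6"
  shows "\<not> gadget_available p False {1,2,3,4,5,6} d" "\<not> gadget_available True True {2,3,4,5,6} d"
proof -
  have "\<forall>d \<in> set order6. (\<forall>p \<in> {True, False}. \<not> gadget_available p False {1,2,3,4,5,6} d) \<and>
      \<not> gadget_available True True {2,3,4,5,6} d"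
    by code_simp
  then show "\<not> gadget_available p False {1,2,3,4,5,6} d" "\<not> gadget_available True True {2,3,4,5,6} d"
    using assms by (cases p; blast)+
qed

section \<open>Six more dimensions\<close>

definition join :: "nat \<Rightarrow> nat set \<Rightarrow> nat set \<Rightarrow> nat set" where
  "join n U X = U \<union> (+) n ` X"

definition upper :: "nat \<Rightarrow> nat set \<Rightarrow> nat set" where
  "upper n w = {i \<in> {1..6}. n + i \<in> w}"

definition lift :: "nat \<Rightarrow> direction \<Rightarrow> direction" where
  "lift n d = (n + fst d, snd d)"

lemma mem_join: "x \<in> join n U X \<longleftrightarrow> x \<in> U \<or> n \<le> x \<and> x - n \<in> X"
  by (auto simp: join_def image_iff intro!: bexI[of _ "x - n"])

lemma join_lower: "U \<subseteq> {1..n} \<Longrightarrow> X \<subseteq> {1..6} \<Longrightarrow> join n U X \<inter> {1..n} = U"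
  by (auto simp: mem_join subset_iff Ball_def)

lemma join_upper: "U \<subseteq> {1..n} \<Longrightarrow> X \<subseteq> {1..6} \<Longrightarrow> upper n (join n U X) = X"
  by (auto simp: mem_join upper_def subset_iff)

lemma join_inverse:
  assumes "w \<in> vertices (n + 6)"
  shows "join n (w \<inter> {1..n}) (upper n w) = w"
proof (rule set_eqI)
  fix x
  have "x \<in> w \<Longrightarrow> 1 \<le> x \<and> x \<le> n + 6" using assms by (auto simp: vertices_def)
  then show "x \<in> join n (w \<inter> {1..n}) (upper n w) \<longleftrightarrow> x \<in> w"
    by (cases "x \<le> n") (auto simp: mem_join upper_def)
qed

lemma join_cases:
  assumes "w \<in> vertices (n + 6)"
  obtains U X where "w = join n U X" "U \<subseteq> {1..n}" "X \<subseteq> {1..6}"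
proof
  show "w = join n (w \<inter> {1..n}) (upper n w)" by (rule join_inverse[OF assms, symmetric])
qed (auto simp: upper_def)

lemma join_top: "{1..n + 6} = join n {1..n} {1..6}"
  by (rule set_eqI) (auto simp: mem_join)

lemma mem_join_lower: "X \<subseteq> {1..6} \<Longrightarrow> j \<le> n \<Longrightarrow> j \<in> join n U X \<longleftrightarrow> j \<in> U"
  by (auto simp: mem_join)

lemma mem_join_upper: "U \<subseteq> {1..n} \<Longrightarrow> 1 \<le> i \<Longrightarrow> n + i \<in> join n U X \<longleftrightarrow> i \<in> X"
  by (auto simp: mem_join)

lemma sym_diff_join_lower:
  "X \<subseteq> {1..6} \<Longrightarrow> j \<in> {1..n} \<Longrightarrow> sym_diff (join n U X) {j} = join n (sym_diff U {j}) X"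
  by (rule set_eqI) (auto simp: mem_join sym_diff_iff)

lemma sym_diff_join_upper:
  assumes "U \<subseteq> {1..n}" "1 \<le> i"
  shows "sym_diff (join n U X) {n + i} = join n U (sym_diff X {i})"
proof (rule set_eqI)
  fix x
  have "x \<in> U \<Longrightarrow> x \<noteq> n + i" using assms by auto
  moreover have "n \<le> x \<Longrightarrow> x = n + i \<longleftrightarrow> x - n = i" by auto
  ultimately show "x \<in> sym_diff (join n U X) {n + i} \<longleftrightarrow> x \<in> join n U (sym_diff X {i})"
    using assms by (auto simp: mem_join sym_diff_iff)
qed

lemma move_join_lower:
  "X \<subseteq> {1..6} \<Longrightarrow> fst d \<in> {1..n} \<Longrightarrow> move (join n U X) d = join n (move U d) X"
  by (rule set_eqI) (auto simp: mem_join move_def)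

lemma move_join_upper:
  assumes "U \<subseteq> {1..n}" "1 \<le> fst d"
  shows "move (join n U X) (lift n d) = join n U (move X d)"
proof (rule set_eqI)
  fix x
  have "x \<in> U \<Longrightarrow> x \<noteq> n + fst d" using assms by auto
  moreover have "n \<le> x \<Longrightarrow> x = n + fst d \<longleftrightarrow> x - n = fst d" by auto
  ultimately show "x \<in> move (join n U X) (lift n d) \<longleftrightarrow> x \<in> join n U (move X d)"
    using assms by (auto simp: mem_join move_def lift_def)
qed

lemma directions_extend: "directions (n + 6) = lift n ` set order6 \<union> directions n"
proof -
  have "d \<in> lift n ` set order6" if "d \<in> directions (n + 6)" "d \<notin> directions n" for d
  proof
    have *: "1 \<le> fst d" "fst d \<le> n + 6" "\<not> fst d \<le> n"
      using that by (auto simp: directions_def mem_Times_iff)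
    then show "d = lift n (fst d - n, snd d)" by (simp add: lift_def)
    have "fst d - n \<in> {1..6}" using * by auto
    then show "(fst d - n, snd d) \<in> set order6" by (auto simp: mem_order6)
  qed
  then show ?thesis by (auto simp: directions_def mem_order6 lift_def)
qed

lemma lift_notin: "d \<in> set order6 \<Longrightarrow> lift n d \<notin> directions n"
  by (auto simp: directions_def mem_order6 lift_def)

lemma inj_lift: "inj (lift n)"
  by (auto simp: inj_def lift_def prod_eq_iff)

lemma before_lift_lift:
  assumes "d \<in> set order6"
  shows "before (map (lift n) order6 @ T) (lift n d) (lift n e) \<longleftrightarrow> before order6 d e"
proof -
  have "takeWhile (\<lambda>x. x \<noteq> lift n d) (map (lift n) order6) =
      map (lift n) (takeWhile (\<lambda>x. x \<noteq> d) order6)"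
    using inj_lift[of n] by (simp add: takeWhile_map comp_def inj_eq)
  moreover have "takeWhile (\<lambda>x. x \<noteq> lift n d) (map (lift n) order6 @ T) =
      takeWhile (\<lambda>x. x \<noteq> lift n d) (map (lift n) order6)"
    using assms by (intro takeWhile_append1) auto
  ultimately show ?thesis
    using inj_lift[of n] by (auto simp: before_def inj_image_mem_iff)
qed

text \<open>New directions win ties against old ones. Hence \<open>gadget_move\<close> needs only a
  weak inequality against the old counts, while \<open>lower_move\<close> needs a strict one against
  the new counts.\<close>

lemma before_lift_lower:
  assumes "d \<in> set order6" "e \<in> directions n"
  shows "before (map (lift n) order6 @ T) (lift n d) e"
proof -
  have "takeWhile (\<lambda>x. x \<noteq> lift n d) (map (lift n) order6 @ T) =
      takeWhile (\<lambda>x. x \<noteq> lift n d) (map (lift n) order6)"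
    using assms(1) by (intro takeWhile_append1) auto
  moreover have "e \<notin> set (takeWhile (\<lambda>x. x \<noteq> lift n d) (map (lift n) order6))"
    using lift_notin[of _ n] assms(2) by (auto dest!: set_takeWhileD)
  ultimately show ?thesis by (simp add: before_def)
qed

lemma before_lower_lower:
  assumes "d \<in> directions n" "e \<in> directions n"
  shows "before (map (lift n) order6 @ T) d e \<longleftrightarrow> before T d e"
proof -
  have "takeWhile (\<lambda>x. x \<noteq> d) (map (lift n) order6 @ T) =
      map (lift n) order6 @ takeWhile (\<lambda>x. x \<noteq> d) T"
    using lift_notin[of _ n] assms(1) by (intro takeWhile_append2) auto
  then show ?thesis using lift_notin[of _ n] assms(2) by (auto simp: before_def)
qed

section \<open>Histories, reachability and resting places in the larger cube\<close>

definition agree :: "nat \<Rightarrow> (direction \<Rightarrow> nat) \<Rightarrow> (direction \<Rightarrow> nat) \<Rightarrow> (direction \<Rightarrow> nat) \<Rightarrow> bool" where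
  "agree n h g H \<longleftrightarrow> (\<forall>d \<in> directions n. H d = h d) \<and> (\<forall>d \<in> set order6. H (lift n d) = g d)"

lemma agree_update_lower:
  "agree n h g H \<Longrightarrow> d \<in> directions n \<Longrightarrow> agree n (h(d := Suc (h d))) g (H(d := Suc (H d)))"
  using lift_notin[of _ n] by (auto simp: agree_def)

lemma agree_update_upper:
  "agree n h g H \<Longrightarrow> d \<in> set order6 \<Longrightarrow>
    agree n h (g(d := Suc (g d))) (H(lift n d := Suc (H (lift n d))))"
  using lift_notin[of d n] inj_lift[of n] by (auto simp: agree_def inj_eq)

lemma agree_cong:
  "agree n h g H \<Longrightarrow> (\<And>d. d \<in> directions n \<Longrightarrow> h d = h' d) \<Longrightarrow>
    (\<And>d. d \<in> set order6 \<Longrightarrow> g d = g' d) \<Longrightarrow> agree n h' g' H"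
  by (simp add: agree_def)

text \<open>Only a lower bound on the number of steps is recorded: the gadget moves need not be
  counted, since the two copies of the old run already double the length.\<close>

definition reaches :: "('s \<Rightarrow> 's \<Rightarrow> bool) \<Rightarrow> nat \<Rightarrow> 's \<Rightarrow> 's \<Rightarrow> bool" where
  "reaches R l s t \<longleftrightarrow> (\<exists>l' \<ge> l. (R ^^ l') s t)"

lemma reaches_refl: "reaches R 0 s s"
  unfolding reaches_def by (rule exI[of _ 0]) simp

lemma reaches_step: "R s t \<Longrightarrow> reaches R 1 s t"
  unfolding reaches_def by (rule exI[of _ 1]) auto

lemma reaches_trans:
  assumes "reaches R a s t" "reaches R b t u"
  shows "reaches R (a + b) s u"
proof -
  obtain i j where "i \<ge> a" "(R ^^ i) s t" "j \<ge> b" "(R ^^ j) t u"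
    using assms by (auto simp: reaches_def)
  then have "a + b \<le> i + j \<and> (R ^^ (i + j)) s u"
    by (auto simp: relpowp_add)
  then show ?thesis unfolding reaches_def by blast
qed

lemma reaches_mono: "reaches R a s t \<Longrightarrow> b \<le> a \<Longrightarrow> reaches R b s t"
  unfolding reaches_def using le_trans by blast

lemma reaches_step_trans: "R s t \<Longrightarrow> reaches R l t u \<Longrightarrow> reaches R l s u"
  using reaches_mono[OF reaches_trans[OF reaches_step], of R s t l u l] by simp

definition low_rest :: "nat \<Rightarrow> nat set" where
  "low_rest r = (if odd r then {6} else {})"

definition low_count :: "nat \<Rightarrow> direction \<Rightarrow> nat" where
  "low_count r d = (if odd r \<and> d \<noteq> (6, False) then Suc (r div 2) else r div 2)"

definition high_rest :: "nat \<Rightarrow> nat set" where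
  "high_rest r = (if odd r \<and> 3 \<le> r then {2,3,4,5,6} else {1,2,3,4,5,6})"

text \<open>Truncated subtraction makes phases 0, 1 and 2 alike. The top walk starts only in phase
  3, one round late, because the positive directions are already one use ahead.\<close>

definition high_count :: "nat \<Rightarrow> direction \<Rightarrow> nat" where
  "high_count r d = (r - 2) div 2 + (if snd d \<or> odd r \<and> 3 \<le> r \<and> d = (1, False) then 1 else 0)"

text \<open>These are the static invariants of the recursion; the run itself is a hypothesis of the
  later lemmas. The run ends in phase \<open>2 * K + 2\<close>, and the sink carries the next value
  \<open>2 * K + 3\<close> so that the phases continue correctly when the larger run leaves
  it.\<close>

locale extension =
  fixes n :: nat and A :: orientation and T :: "direction list" and \<phi> :: "nat set \<Rightarrow> nat" and K :: nat
  assumes n_pos: "n > 0"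
    and A_separated: "separated n A"
    and A_ranked: "ranked n A"
    and T_distinct: "distinct T"
    and T_set: "set T = directions n"
    and A_sink: "\<And>j. j \<in> {1..n} \<Longrightarrow> \<not> A {1..n} j"
    and phase_start: "\<phi> {} = 1"
    and phase_sink: "\<phi> {1..n} = 2 * K + 3"
begin

text \<open>The old sink has an odd phase but is excepted: there \<open>X\<close> must climb without
  detours, and the full set must remain a sink of the gadget.\<close>

definition low_type :: "nat set \<Rightarrow> bool" where
  "low_type U \<longleftrightarrow> odd (\<phi> U) \<and> U \<noteq> {1..n}"

definition high_type :: "nat set \<Rightarrow> bool" where
  "high_type U \<longleftrightarrow> low_type U \<and> 3 \<le> \<phi> U"

definition ext_out :: orientation where
  "ext_out w j = (let U = w \<inter> {1..n}; X = upper n w in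
     if j \<le> n then (if level X = 1 then j \<in> U else A U j)
     else gadget (low_type U) (high_type U) X (j - n))"

definition ext_list :: "direction list" where
  "ext_list = map (lift n) order6 @ T"

text \<open>In the low range a round begins at \<open>X = {}\<close> with its odd phase, and every
  other \<open>X\<close> gets the following even number. In the top range the old phases are shifted
  by \<open>K + 1\<close> rounds, and \<open>max\<close> absorbs those before phase 3. Away from the
  resting place the value is one smaller there, since the gadget walk precedes the old move that
  enters the new phase.\<close>

definition ext_phase :: "nat set \<Rightarrow> nat" where
  "ext_phase w = (let U = w \<inter> {1..n}; X = upper n w in
     if level X = 2 then (if X = {} then \<phi> U else 2 * (Suc (\<phi> U) div 2))
     else if level X = 1 then 2 * K + 4
     else if X = (if high_type U then {2,3,4,5,6} else {1,2,3,4,5,6})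
       then max (2 * K + 4) (2 * K + 2 + \<phi> U)
     else max (2 * K + 4) (2 * K + 1 + \<phi> U))"

section \<open>The extended orientation is an acyclic unique sink orientation\<close>

lemma ext_out_lower:
  "U \<subseteq> {1..n} \<Longrightarrow> X \<subseteq> {1..6} \<Longrightarrow> j \<le> n \<Longrightarrow>
    ext_out (join n U X) j = (if level X = 1 then j \<in> U else A U j)"
  by (simp add: ext_out_def Let_def join_lower join_upper del: One_nat_def)

lemma ext_out_upper:
  "U \<subseteq> {1..n} \<Longrightarrow> X \<subseteq> {1..6} \<Longrightarrow> 1 \<le> i \<Longrightarrow>
    ext_out (join n U X) (n + i) = gadget (low_type U) (high_type U) X i"
  by (simp add: ext_out_def Let_def join_lower join_upper del: One_nat_def)

text \<open>For different lower parts on a common level an old coordinate decides, since both sides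
  carry the same separated orientation. Otherwise the flags agree or the levels differ, which is
  what \<open>gadget_separated\<close> requires.\<close>

lemma ext_separated: "separated (n + 6) ext_out"
  unfolding separated_def
proof (intro ballI impI)
  fix w w' assume "w \<in> vertices (n + 6)" "w' \<in> vertices (n + 6)" and ne: "w \<noteq> w'"
  then obtain U X V Y where w: "w = join n U X" "U \<subseteq> {1..n}" "X \<subseteq> {1..6}"
    and w': "w' = join n V Y" "V \<subseteq> {1..n}" "Y \<subseteq> {1..6}"
    by (elim join_cases)
  show "\<exists>j \<in> sym_diff w w'. ext_out w j \<noteq> ext_out w' j"
  proof (cases "U \<noteq> V \<and> level X = level Y")
    case True
    have "\<exists>j \<in> sym_diff U V. (if level X = 1 then j \<in> U else A U j) \<noteq>
        (if level Y = 1 then j \<in> V else A V j)"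
    proof (cases "level X = 1")
      case True
      then show ?thesis using \<open>U \<noteq> V \<and> level X = level Y\<close> by (auto simp: sym_diff_iff)
    next
      case False
      have "\<exists>j \<in> sym_diff U V. A U j \<noteq> A V j"
        using A_separated True w(2) w'(2) unfolding separated_def vertices_def by blast
      then show ?thesis using True False by simp
    qed
    then obtain j where j: "j \<in> sym_diff U V" "(if level X = 1 then j \<in> U else A U j) \<noteq>
        (if level Y = 1 then j \<in> V else A V j)" by blast
    have "j \<le> n" using j(1) w(2) w'(2) by (auto simp: sym_diff_def)
    then have "ext_out w j \<noteq> ext_out w' j"
      using j(2) ext_out_lower[OF w(2,3)] ext_out_lower[OF w'(2,3)] w(1) w'(1) by simp
    moreover have "j \<in> sym_diff w w'"
      using j(1) \<open>j \<le> n\<close> w w' by (simp add: sym_diff_iff mem_join_lower)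
    ultimately show ?thesis by blast
  next
    case False
    then have "X \<noteq> Y" "U = V \<or> level X \<noteq> level Y" using ne w(1) w'(1) by auto
    then obtain i where i: "i \<in> sym_diff X Y"
      "gadget (low_type U) (high_type U) X i \<noteq> gadget (low_type V) (high_type V) Y i"
      using gadget_separated[OF w(3) w'(3)] by metis
    have "1 \<le> i" using i(1) w(3) w'(3) by (auto simp: sym_diff_def)
    then have "ext_out w (n + i) \<noteq> ext_out w' (n + i)"
      using i(2) ext_out_upper[OF w(2,3)] ext_out_upper[OF w'(2,3)] w(1) w'(1) by simp
    moreover have "n + i \<in> sym_diff w w'"
      using i(1) \<open>1 \<le> i\<close> w w' by (simp add: sym_diff_iff mem_join_upper)
    ultimately show ?thesis by blast
  qed
qed

lemma ext_ranked: "ranked (n + 6) ext_out"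
proof -
  obtain \<rho> :: "nat set \<Rightarrow> nat" where \<rho>: "\<And>U j. U \<in> vertices n \<Longrightarrow> j \<in> {1..n} \<Longrightarrow> A U j \<Longrightarrow>
      \<rho> (sym_diff U {j}) < \<rho> U"
    using A_ranked unfolding ranked_def by blast
  \<comment> \<open>\<open>B\<close> exceeds all values of both inner potentials, the old rank and
    the cardinality, so a drop of the level outweighs the change of inner potential.\<close>
  define B where "B = Suc (n + Max (\<rho> ` vertices n))"
  define inner where "inner X U = (if level X = 1 then card U else \<rho> U)" for X U
  \<comment> \<open>Lexicographic order of level, inner potential and gadget rank. The last may
    change arbitrarily when \<open>U\<close> moves and changes the flags; being at most 20 it is
    absorbed by the factor 21.\<close>
  define rank where "rank w = (let U = w \<inter> {1..n}; X = upper n w in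
    (level X * B + inner X U) * 21 + gadget_rank (low_type U) (high_type U) X)" for w
  have rank_join: "rank (join n U X) =
      (level X * B + inner X U) * 21 + gadget_rank (low_type U) (high_type U) X"
    if "U \<subseteq> {1..n}" "X \<subseteq> {1..6}" for U X
    using that by (simp add: rank_def Let_def join_lower join_upper del: One_nat_def)
  have inner_less: "inner X U < B" if "U \<subseteq> {1..n}" for X U
  proof -
    have "card U \<le> n" using card_mono[OF _ that] by simp
    moreover have "\<rho> U \<le> Max (\<rho> ` vertices n)"
      using that by (intro Max_ge) (auto simp: vertices_def)
    ultimately show ?thesis by (simp add: inner_def B_def)
  qed
  have "rank (sym_diff w {j}) < rank w"
    if w: "w \<in> vertices (n + 6)" and j: "j \<in> {1..n + 6}" and out: "ext_out w j" for w j
  proof -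
    obtain U X where UX: "w = join n U X" "U \<subseteq> {1..n}" "X \<subseteq> {1..6}"
      using w by (rule join_cases)
    show ?thesis
    proof (cases "j \<le> n")
      case True
      let ?V = "sym_diff U {j}"
      have V: "?V \<subseteq> {1..n}" using UX(2) j True by (auto simp: sym_diff_def)
      have dec: "inner X ?V < inner X U"
      proof (cases "level X = 1")
        case lev: True
        then have "j \<in> U" using out True UX by (simp add: ext_out_lower)
        moreover have "?V = U - {j}" using \<open>j \<in> U\<close> by (auto simp: sym_diff_def)
        moreover have "finite U" using UX(2) finite_subset by blast
        ultimately have "card ?V < card U" using card_Diff1_less[of U j] by simp
        then show ?thesis using lev by (simp add: inner_def)
      next
        case False
        then show ?thesis using out True UX \<rho>[of U j] j
          by (simp add: ext_out_lower inner_def vertices_def)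
      qed
      have "sym_diff w {j} = join n ?V X" using UX True j by (simp add: sym_diff_join_lower)
      then show ?thesis
        using dec gadget_rank_le[of "low_type ?V" "high_type ?V" X]
        unfolding UX(1) by (simp add: rank_join[OF V UX(3)] rank_join[OF UX(2,3)])
    next
      case False
      define i where "i = j - n"
      have i: "j = n + i" "i \<in> {1..6}" using False j by (auto simp: i_def)
      let ?Y = "sym_diff X {i}"
      have Y: "?Y \<subseteq> {1..6}" using UX(3) i(2) by (auto simp: sym_diff_def)
      have g: "gadget (low_type U) (high_type U) X i"
        using out UX i by (simp add: ext_out_upper)
      have eq: "sym_diff w {j} = join n U ?Y" using UX i by (simp add: sym_diff_join_upper)
      show ?thesis
        using gadget_edge[OF UX(3) i(2) g]
      proof
        assume "level ?Y < level X"
        then have "Suc (level ?Y) * B \<le> level X * B" by (intro mult_le_mono1) simp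
        then have "level ?Y * B + inner ?Y U < level X * B + inner X U"
          using inner_less[OF UX(2), of ?Y] by simp
        then show ?thesis
          unfolding eq unfolding UX(1)
          using gadget_rank_le[of "low_type U" "high_type U" ?Y]
          by (simp add: rank_join[OF UX(2) Y] rank_join[OF UX(2,3)])
      next
        assume "level ?Y = level X \<and> gadget_rank (low_type U) (high_type U) ?Y <
          gadget_rank (low_type U) (high_type U) X"
        then show ?thesis
          unfolding eq unfolding UX(1) by (simp add: rank_join[OF UX(2) Y] rank_join[OF UX(2,3)] inner_def)
      qed
    qed
  qed
  then show ?thesis unfolding ranked_def by blast
qed

lemma ext_list_set: "set ext_list = directions (n + 6)"
  by (simp add: ext_list_def T_set directions_extend)

lemma ext_list_distinct: "distinct ext_list"
proof -
  have "distinct (map (lift n) order6)"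
    using inj_lift[of n] by (simp add: distinct_map order6_def inj_on_def lift_def)
  then show ?thesis using T_distinct T_set lift_notin by (auto simp: ext_list_def)
qed

lemma ext_sink:
  assumes j: "j \<in> {1..n + 6}"
  shows "\<not> ext_out {1..n + 6} j"
proof -
  show ?thesis
  proof (cases "j \<le> n")
    case True
    then show ?thesis unfolding join_top using j A_sink[of j] by (simp add: ext_out_lower level_def)
  next
    case False
    define i where "i = j - n"
    have i: "j = n + i" "1 \<le> i" "i \<in> {1..6}" using False j by (auto simp: i_def)
    have *: "{1..6} = {1,2,3,4,5,6::nat}" by auto
    have "\<not> gadget False False {1..6} i"
      using high_rest_unavailable(1)[of "(i, False)" False] i(3) unfolding *
      by (simp add: mem_order6 gadget_available_def)
    then show ?thesis unfolding join_top i(1) ext_out_upper[OF order_refl order_refl i(2)]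
      by (simp add: low_type_def high_type_def)
  qed
qed

end

section \<open>Simulating the run in the larger cube\<close>

context extension
begin

abbreviation ext_step :: "zstate \<Rightarrow> zstate \<Rightarrow> bool" where
  "ext_step \<equiv> zphase_step (n + 6) ext_out ext_list ext_phase"

section \<open>Single moves, the return and gadget walks in the larger cube\<close>

lemma available_lift:
  assumes "U \<subseteq> {1..n}" "X \<subseteq> {1..6}" "d \<in> set order6"
  shows "available (n + 6) ext_out (join n U X) (lift n d) \<longleftrightarrow>
    gadget_available (low_type U) (high_type U) X d"
proof -
  have "1 \<le> fst d" "fst d \<le> 6" using assms(3) by (auto simp: mem_order6)
  then show ?thesis
    using ext_out_upper[OF assms(1,2), of "fst d"] mem_join_upper[OF assms(1), of "fst d" X]
    by (simp add: available_def gadget_available_def lift_def)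
qed

lemma available_lower:
  assumes "U \<subseteq> {1..n}" "X \<subseteq> {1..6}" "d \<in> directions n"
  shows "available (n + 6) ext_out (join n U X) d \<longleftrightarrow>
    (if level X = 1 then \<not> snd d \<and> fst d \<in> U else available n A U d)"
proof -
  have d: "1 \<le> fst d" "fst d \<le> n" using assms(3) by (auto simp: directions_def mem_Times_iff)
  show ?thesis
    using d ext_out_lower[OF assms(1,2) d(2)] mem_join_lower[OF assms(2) d(2), of U]
    by (cases "level X = 1") (simp_all add: available_def, blast)
qed

lemma available_ext_cases:
  assumes "available (n + 6) ext_out w e"
  obtains e' where "e' \<in> set order6" "e = lift n e'" | "e \<in> directions n"
  using available_directions[OF assms] by (auto simp: directions_extend)

lemma available_sink: "\<not> available n A {1..n} e"
  using A_sink by (auto simp: available_def)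

lemma gadget_move:
  assumes UX: "U \<subseteq> {1..n}" "X \<subseteq> {1..6}" and ag: "agree n h g H"
    and d: "d \<in> set order6" "gadget_available (low_type U) (high_type U) X d"
    and best: "\<And>e. e \<in> set order6 \<Longrightarrow> gadget_available (low_type U) (high_type U) X e \<Longrightarrow>
      g d < g e \<or> g d = g e \<and> before order6 d e"
    and lower: "\<And>e. available n A U e \<Longrightarrow> level X \<noteq> 1 \<Longrightarrow> g d \<le> h e"
    and returning: "level X = 1 \<Longrightarrow> U = {}"
    and phase: "ext_phase (join n U X) = r'" "2 * g d + 1 \<le> r'"
      "r' = r \<or> r' = Suc r \<and> g d = r div 2"
  shows "\<exists>H'. ext_step (r, join n U X, H) (r', join n U (move X d), H') \<and>
    agree n h (g(d := Suc (g d))) H'"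
proof -
  have Hd: "H (lift n d) = g d" using ag d(1) by (simp add: agree_def)
  have "zbest (n + 6) ext_out ext_list (join n U X) H (lift n d)"
    unfolding zbest_def
  proof (intro conjI allI impI)
    show "available (n + 6) ext_out (join n U X) (lift n d)"
      using available_lift[OF UX d(1)] d(2) by simp
    fix e assume av: "available (n + 6) ext_out (join n U X) e"
    from av show "H (lift n d) < H e \<or> H (lift n d) = H e \<and> before ext_list (lift n d) e"
    proof (cases rule: available_ext_cases)
      case (1 e')
      then have "gadget_available (low_type U) (high_type U) X e'"
        using av available_lift[OF UX 1(1)] by simp
      then show ?thesis
        using best[OF 1(1)] 1 ag Hd d(1) by (simp add: agree_def ext_list_def before_lift_lift)
    next
      case 2
      then have "level X \<noteq> 1" "available n A U e"
        using av available_lower[OF UX 2] returning by (auto split: if_splits)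
      then have "g d \<le> H e" using lower ag 2 by (simp add: agree_def)
      then show ?thesis
        using Hd d(1) 2 by (auto simp: ext_list_def before_lift_lower)
    qed
  qed
  then have "ext_step (r, join n U X, H)
      (r', move (join n U X) (lift n d), H(lift n d := Suc (H (lift n d))))"
    using phase Hd by (intro zphase_stepI) auto
  moreover have "move (join n U X) (lift n d) = join n U (move X d)"
    using UX(1) d(1) by (intro move_join_upper) (auto simp: mem_order6)
  ultimately show ?thesis using agree_update_upper[OF ag d(1)] by metis
qed

text \<open>A common offset \<open>N\<close> leaves all comparisons between old directions
  unchanged. It is 0 in the first copy of the old run and \<open>Suc K\<close> in the
  second.\<close>

lemma lower_move:
  assumes UX: "U \<subseteq> {1..n}" "X \<subseteq> {1..6}" and ag: "agree n (\<lambda>e. h e + N) g H"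
    and d: "zbest n A T U h d" and lev: "level X \<noteq> 1"
    and waiting: "\<And>e. e \<in> set order6 \<Longrightarrow> gadget_available (low_type U) (high_type U) X e \<Longrightarrow>
      h d + N < g e"
    and phase: "ext_phase (join n U X) = r'" "2 * (h d + N) + 1 \<le> r'"
      "r' = r \<or> r' = Suc r \<and> h d + N = r div 2"
  shows "\<exists>H'. ext_step (r, join n U X, H) (r', join n (move U d) X, H') \<and>
    agree n (\<lambda>e. (h(d := Suc (h d))) e + N) g H'"
proof -
  have av: "available n A U d" using d by (simp add: zbest_def)
  then have dn: "d \<in> directions n" by (rule available_directions)
  have Hd: "H d = h d + N" using ag dn by (simp add: agree_def)
  have "zbest (n + 6) ext_out ext_list (join n U X) H d"
    unfolding zbest_def
  proof (intro conjI allI impI)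
    show "available (n + 6) ext_out (join n U X) d"
      using available_lower[OF UX dn] lev av by simp
    fix e assume ave: "available (n + 6) ext_out (join n U X) e"
    from ave show "H d < H e \<or> H d = H e \<and> before ext_list d e"
    proof (cases rule: available_ext_cases)
      case (1 e')
      then have "gadget_available (low_type U) (high_type U) X e'"
        using ave available_lift[OF UX 1(1)] by simp
      then show ?thesis using waiting[OF 1(1)] 1 ag Hd by (simp add: agree_def)
    next
      case 2
      then have "available n A U e" using ave available_lower[OF UX 2] lev by simp
      then have "h d < h e \<or> h d = h e \<and> before T d e" using d unfolding zbest_def by blast
      then show ?thesis
        using Hd ag 2 dn by (auto simp: agree_def ext_list_def before_lower_lower)
    qed
  qed
  then have "ext_step (r, join n U X, H) (r', move (join n U X) d, H(d := Suc (H d)))"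
    using phase Hd by (intro zphase_stepI) auto
  moreover have "move (join n U X) d = join n (move U d) X"
    using UX(2) dn by (intro move_join_lower) (auto simp: directions_def)
  moreover have "agree n (\<lambda>e. (h(d := Suc (h d))) e + N) g (H(d := Suc (H d)))"
    using agree_update_lower[OF ag dn] by (rule agree_cong) (auto simp: fun_upd_def)
  ultimately show ?thesis by metis
qed

text \<open>The only available old directions are the downward ones at elements of \<open>U\<close>,
  all with count \<open>K\<close>, whereas new directions have count at least \<open>Suc K\<close>.
  So an old downward direction is chosen each time, and its identity is irrelevant because the final
  counts are all equal.\<close>

lemma return_run:
  assumes "U \<subseteq> {1..n}" "X \<subseteq> {1..6}" "level X = 1" "agree n h g H"
    and "\<And>c. c \<in> {1..n} \<Longrightarrow> h (c, True) = Suc K \<and> h (c, False) = (if c \<in> U then K else Suc K)"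
    and "\<And>d. d \<in> set order6 \<Longrightarrow> Suc K \<le> g d"
  shows "\<exists>H'. reaches ext_step 0 (2 * K + 4, join n U X, H) (2 * K + 4, join n {} X, H') \<and>
    agree n (\<lambda>_. Suc K) g H'"
  using assms
proof (induction "card U" arbitrary: U h H)
  case 0
  then have U: "U = {}" using finite_subset by fastforce
  have "h d = Suc K" if "d \<in> directions n" for d
    using 0(6)[of "fst d"] that U by (cases d; cases "snd d") (auto simp: directions_def)
  then have "agree n (\<lambda>_. Suc K) g H" by (intro agree_cong[OF 0(5)]) auto
  then show ?case unfolding U by (intro exI[of _ H] conjI reaches_refl)
next
  case (Suc k)
  note UX = Suc.prems(1,2)
  have fin: "finite U" using UX(1) finite_subset by blast
  obtain c where c: "c \<in> U" using Suc.hyps(2) by fastforce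
  then have cn: "(c, False) \<in> directions n" using UX(1) by (auto simp: directions_def)
  have avc: "available (n + 6) ext_out (join n U X) (c, False)"
    using available_lower[OF UX cn] Suc.prems(3) c by simp
  then obtain d where d: "zbest (n + 6) ext_out ext_list (join n U X) H d"
    using zbest_exists ext_list_set by blast
  have "H d < H (c, False) \<or> H d = H (c, False) \<and> before ext_list d (c, False)"
    using d avc unfolding zbest_def by blast
  then have "H d \<le> H (c, False)" by auto
  also have "H (c, False) = h (c, False)" using Suc.prems(4) cn unfolding agree_def by blast
  also have "\<dots> = K" using Suc.prems(5)[of c] c UX(1) by auto
  finally have HdK: "H d \<le> K" .
  have av: "available (n + 6) ext_out (join n U X) d" using d by (simp add: zbest_def)
  then have dn: "d \<in> directions n"
  proof (cases rule: available_ext_cases)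
    case (1 e')
    then have "Suc K \<le> H d" using Suc.prems(4) Suc.prems(6) by (simp add: agree_def)
    then show ?thesis using HdK by simp
  qed simp
  then have dU: "\<not> snd d" "fst d \<in> U"
    using available_lower[OF UX dn] av Suc.prems(3) by simp_all
  have "H d = h (fst d, False)" using Suc.prems(4) dn dU(1) by (cases d) (simp add: agree_def)
  then have Hd: "H d = K" using Suc.prems(5)[of "fst d"] dU(2) UX(1) by auto
  have "ext_phase (join n U X) = 2 * K + 4"
    using UX Suc.prems(3) by (simp add: ext_phase_def Let_def join_upper del: One_nat_def)
  then have step: "ext_step (2 * K + 4, join n U X, H)
      (2 * K + 4, move (join n U X) d, H(d := Suc (H d)))"
    by (rule zphase_stepI[OF d]) (simp_all add: Hd)
  have mv: "move (join n U X) d = join n (U - {fst d}) X"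
    using move_join_lower[OF UX(2), of d n U] dn dU(1)
    by (simp add: directions_def move_def mem_Times_iff)
  have "\<exists>H'. reaches ext_step 0 (2 * K + 4, join n (U - {fst d}) X, H(d := Suc (H d)))
      (2 * K + 4, join n {} X, H') \<and> agree n (\<lambda>_. Suc K) g H'"
  proof (rule Suc.hyps(1)[of "U - {fst d}" "h(d := Suc (h d))"])
    show "k = card (U - {fst d})" using Suc.hyps(2) dU(2) fin by simp
    show "agree n (h(d := Suc (h d))) g (H(d := Suc (H d)))"
      by (rule agree_update_lower[OF Suc.prems(4) dn])
    show "(h(d := Suc (h d))) (c, True) = Suc K \<and>
        (h(d := Suc (h d))) (c, False) = (if c \<in> U - {fst d} then K else Suc K)"
      if "c \<in> {1..n}" for c
      using Suc.prems(5)[OF that] dU by (cases d) auto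
    show "U - {fst d} \<subseteq> {1..n}" using UX(1) by blast
  qed (fact Suc.prems)+
  then show ?case using reaches_step_trans[of ext_step, OF step, of 0] unfolding mv by blast
qed

text \<open>Transfers a computed walk to the cube. The available old directions have count at least
  \<open>j + b\<close>, the largest count a move of the walk may have, and lose ties, so
  \<open>U\<close> stays fixed throughout.\<close>

lemma walk_run:
  assumes "walk lv (low_type U) (high_type U) f b (r', Y, c') (r, X, c) ds"
    and U: "U \<subseteq> {1..n}" and "X \<subseteq> {1..6}" and lv: "lv \<noteq> 1"
    and "agree n h (\<lambda>d. j + c d) H"
    and lower: "\<And>e. available n A U e \<Longrightarrow> j + b \<le> h e"
    and phase: "\<And>Z. Z \<subseteq> {1..6} \<Longrightarrow> level Z = lv \<Longrightarrow> ext_phase (join n U Z) = 2 * j + f Z"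
  shows "\<exists>H'. reaches ext_step 0 (2 * j + r, join n U X, H) (2 * j + r', join n U Y, H') \<and>
    agree n h (\<lambda>d. j + c' d) H'"
  using assms(1,3,5)
proof (induction ds arbitrary: r X c H)
  case Nil
  then have "agree n h (\<lambda>d. j + c' d) H" using Nil.prems(1) by (intro agree_cong[OF Nil.prems(3)]) (simp_all add: walk.simps)
  moreover have "r = r'" "X = Y" using Nil.prems(1) by (simp_all add: walk.simps)
  ultimately show ?case by (intro exI[of _ H] conjI) (simp_all add: reaches_refl)
next
  case (Cons d ds)
  from Cons.prems(1) have d: "d \<in> set order6" "gadget_available (low_type U) (high_type U) X d"
    and lev: "level X = lv"
    and best: "\<And>e. e \<in> set order6 \<Longrightarrow> gadget_available (low_type U) (high_type U) X e \<Longrightarrow>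
      c d < c e \<or> c d = c e \<and> before order6 d e"
    and bnd: "c d \<le> b" "2 * c d + 1 \<le> f X" "f X = r \<or> f X = Suc r \<and> c d = r div 2"
    and rest: "walk lv (low_type U) (high_type U) f b (r', Y, c')
      (f X, move X d, c(d := Suc (c d))) ds"
    by (simp_all add: walk.simps)
  have "\<exists>H1. ext_step (2 * j + r, join n U X, H) (2 * j + f X, join n U (move X d), H1) \<and>
      agree n h ((\<lambda>d. j + c d)(d := Suc (j + c d))) H1"
  proof (rule gadget_move[OF U Cons.prems(2,3) d])
    show "j + c d < j + c e \<or> j + c d = j + c e \<and> before order6 d e"
      if "e \<in> set order6" "gadget_available (low_type U) (high_type U) X e" for e
      using best[OF that] by simp
    show "j + c d \<le> h e" if "available n A U e" for e
      using lower[OF that] bnd(1) by simp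
    show "ext_phase (join n U X) = 2 * j + f X" by (rule phase[OF Cons.prems(2) lev])
  qed (use lev lv bnd in auto)
  then obtain H1 where H1:
    "ext_step (2 * j + r, join n U X, H) (2 * j + f X, join n U (move X d), H1)"
    "agree n h ((\<lambda>d. j + c d)(d := Suc (j + c d))) H1"
    by blast
  have "agree n h (\<lambda>e. j + (c(d := Suc (c d))) e) H1"
    using H1(2) by (rule agree_cong) auto
  moreover have "move X d \<subseteq> {1..6}"
    using Cons.prems(2) d(1) by (auto simp: move_def mem_order6)
  ultimately obtain H' where
    "reaches ext_step 0 (2 * j + f X, join n U (move X d), H1) (2 * j + r', join n U Y, H')"
    "agree n h (\<lambda>d. j + c' d) H'"
    using Cons.IH[OF rest] by blast
  then show ?case using reaches_step_trans[of ext_step, OF H1(1)] by blast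
qed

lemma ext_phase_join:
  assumes "U \<subseteq> {1..n}" "X \<subseteq> {1..6}"
  shows "ext_phase (join n U X) =
     (if level X = 2 then (if X = {} then \<phi> U else 2 * (Suc (\<phi> U) div 2))
     else if level X = 1 then 2 * K + 4
     else if X = (if high_type U then {2,3,4,5,6} else {1,2,3,4,5,6})
       then max (2 * K + 4) (2 * K + 2 + \<phi> U)
     else max (2 * K + 4) (2 * K + 1 + \<phi> U))"
  by (simp add: ext_phase_def Let_def join_lower[OF assms] join_upper[OF assms] del: One_nat_def)

section \<open>The two copies of the old run\<close>

lemma step_phase_types:
  assumes "zbest n A T U h d"
  shows "low_type U \<longleftrightarrow> odd (\<phi> U)" "high_type U \<longleftrightarrow> odd (\<phi> U) \<and> 3 \<le> \<phi> U"
proof -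
  have "U \<noteq> {1..n}" using assms available_sink unfolding zbest_def by blast
  then show "low_type U \<longleftrightarrow> odd (\<phi> U)" "high_type U \<longleftrightarrow> odd (\<phi> U) \<and> 3 \<le> \<phi> U"
    by (auto simp: low_type_def high_type_def)
qed

text \<open>Each old move that enters a new phase \<open>r\<close> is preceded by the walk that
  brings \<open>X\<close> to \<open>low_rest r\<close>; then the old move is repeated
  unchanged.\<close>

lemma first_run:
  assumes "(zphase_step n A T \<phi> ^^ l) (0, {}, \<lambda>_. 0) (r, U, h)"
  shows "U \<subseteq> {1..n} \<and> (\<exists>H. reaches ext_step l (0, {}, \<lambda>_. 0)
    (2 * (Suc r div 2), join n U (low_rest r), H) \<and> agree n h (low_count r) H)"
  using assms
proof (induction l arbitrary: r U h)
  case 0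
  have "reaches ext_step 0 (0, {}, \<lambda>_. 0)
      (2 * (Suc 0 div 2), join n {} (low_rest 0), \<lambda>_. 0)"
    using reaches_refl[of ext_step "(0, {}, \<lambda>_. 0)"] by (simp add: join_def low_rest_def)
  moreover have "agree n (\<lambda>_. 0) (low_count 0) (\<lambda>_. 0)"
    by (simp add: agree_def low_count_def)
  ultimately show ?case using 0 by auto
next
  case (Suc l)
  obtain s where "(zphase_step n A T \<phi> ^^ l) (0, {}, \<lambda>_. 0) s"
    "zphase_step n A T \<phi> s (r, U, h)"
    using Suc.prems by (rule relpowp_Suc_E)
  moreover obtain r0 U0 h0 where "s = (r0, U0, h0)" by (cases s)
  ultimately have run: "(zphase_step n A T \<phi> ^^ l) (0, {}, \<lambda>_. 0) (r0, U0, h0)"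
    and step: "zphase_step n A T \<phi> (r0, U0, h0) (r, U, h)" by simp_all
  obtain H0 where U0: "U0 \<subseteq> {1..n}"
    and H0: "reaches ext_step l (0, {}, \<lambda>_. 0) (2 * (Suc r0 div 2), join n U0 (low_rest r0), H0)"
    "agree n h0 (low_count r0) H0"
    using Suc.IH[OF run] by blast
  obtain d where d: "zbest n A T U0 h0 d" "r = \<phi> U0" "2 * h0 d + 1 \<le> r"
    "r = r0 \<or> r = Suc r0 \<and> h0 d = r0 div 2" "U = move U0 d" "h = h0(d := Suc (h0 d))"
    using step by (rule zphase_stepE)
  have low: "low_type U0 \<longleftrightarrow> odd r" using step_phase_types[OF d(1)] d(2) by simp
  have q: "high_type U0 \<in> {True, False}" by blast
  have "\<exists>H1. reaches ext_step 0 (2 * (Suc r0 div 2), join n U0 (low_rest r0), H0)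
      (2 * (Suc r div 2), join n U0 (low_rest r), H1) \<and> agree n h0 (low_count r) H1"
  proof (cases "r = r0")
    case True
    then show ?thesis using H0(2) by (intro exI[of _ H0] conjI) (simp_all add: reaches_refl)
  next
    case False
    then have rS: "r = Suc r0" and hd: "h0 d = r0 div 2" using d(4) by auto
    define j where "j = r0 div 2"
    \<comment> \<open>The old run enters the new phase by a direction used exactly \<open>j\<close>
      times, and that direction is least used. So every available old direction waits for the
      walk.\<close>
    have lower: "j + 0 \<le> h0 e" if "available n A U0 e" for e
      using zbest_le[OF d(1) that] hd by (simp add: j_def)
    show ?thesis
    proof (cases "even r0")
      case True
      then have r0: "r0 = 2 * j" by (simp add: j_def)
      then have \<phi>U: "\<phi> U0 = Suc (2 * j)" using d(2) rS by simp
      then have lowT: "low_type U0" using low d(2) by simp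
      have "\<exists>H1. reaches ext_step 0 (2 * j + 0, join n U0 {}, H0) (2 * j + 2, join n U0 {6}, H1) \<and>
          agree n h0 (\<lambda>d. j + (if d = (6, False) then 0 else 1)) H1"
      proof (rule walk_run[OF _ U0 _ _ _ lower])
        show "walk 2 (low_type U0) (high_type U0) (\<lambda>X. if X = {} then 1 else 2) 0
            (2, {6}, \<lambda>d. if d = (6, False) then 0 else 1) (0, {}, \<lambda>_. 0)
            [(1,True), (2,True), (1,False), (3,True), (2,False), (4,True), (3,False),
             (5,True), (4,False), (6,True), (5,False)]"
          by (simp only: bspec[OF walk_up_low q] lowT)
        show "agree n h0 (\<lambda>d. j + 0) H0"
          by (rule agree_cong[OF H0(2)]) (simp_all add: low_count_def r0)
        show "ext_phase (join n U0 Z) = 2 * j + (if Z = {} then 1 else 2)"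
          if "Z \<subseteq> {1..6}" "level Z = 2" for Z
          using ext_phase_join[OF U0 that(1)] that(2) by (simp add: \<phi>U)
      qed simp_all
      then obtain H1 where
        "reaches ext_step 0 (2 * j + 0, join n U0 {}, H0) (2 * j + 2, join n U0 {6}, H1)"
        "agree n h0 (\<lambda>d. j + (if d = (6, False) then 0 else 1)) H1" by blast
      moreover have "agree n h0 (low_count r) H1"
        by (rule agree_cong[OF calculation(2)]) (simp_all add: low_count_def rS r0)
      ultimately show ?thesis
        by (intro exI[of _ H1] conjI) (simp_all add: low_rest_def rS r0)
    next
      case False
      then have r0: "r0 = Suc (2 * j)" by (simp add: j_def)
      then have \<phi>U: "\<phi> U0 = 2 * j + 2" using d(2) rS by simp
      then have lowF: "\<not> low_type U0" using low d(2) by simp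
      have "\<exists>H1. reaches ext_step 0 (2 * j + 2, join n U0 {6}, H0) (2 * j + 2, join n U0 {}, H1) \<and>
          agree n h0 (\<lambda>d. j + 1) H1"
      proof (rule walk_run[OF _ U0 _ _ _ lower])
        show "walk 2 (low_type U0) (high_type U0) (\<lambda>X. 2) 0
            (2, {}, \<lambda>d. 1) (2, {6}, \<lambda>d. if d = (6, False) then 0 else 1) [(6,False)]"
          by (simp only: bspec[OF walk_down_low q] lowF)
        show "agree n h0 (\<lambda>d. j + (if d = (6, False) then 0 else 1)) H0"
          by (rule agree_cong[OF H0(2)]) (simp_all add: low_count_def r0)
        show "ext_phase (join n U0 Z) = 2 * j + 2"
          if "Z \<subseteq> {1..6}" "level Z = 2" for Z
          using ext_phase_join[OF U0 that(1)] that(2) by (simp add: \<phi>U)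
      qed simp_all
      then obtain H1 where
        "reaches ext_step 0 (2 * j + 2, join n U0 {6}, H0) (2 * j + 2, join n U0 {}, H1)"
        "agree n h0 (\<lambda>d. j + 1) H1" by blast
      moreover have "agree n h0 (low_count r) H1"
        by (rule agree_cong[OF calculation(2)]) (simp_all add: low_count_def rS r0)
      ultimately show ?thesis
        by (intro exI[of _ H1] conjI) (simp_all add: low_rest_def rS r0)
    qed
  qed
  then obtain H1 where H1: "reaches ext_step 0 (2 * (Suc r0 div 2), join n U0 (low_rest r0), H0)
      (2 * (Suc r div 2), join n U0 (low_rest r), H1)" "agree n h0 (low_count r) H1" by blast
  have rest: "low_rest r \<subseteq> {1..6}" "level (low_rest r) = 2"
    by (simp_all add: low_rest_def level_def)
  have "\<exists>H'. ext_step (2 * (Suc r div 2), join n U0 (low_rest r), H1)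
      (2 * (Suc r div 2), join n (move U0 d) (low_rest r), H') \<and>
      agree n (\<lambda>e. (h0(d := Suc (h0 d))) e + 0) (low_count r) H'"
  proof (rule lower_move[OF U0 rest(1) _ d(1)])
    show "agree n (\<lambda>e. h0 e + 0) (low_count r) H1" using H1(2) by simp
    show "h0 d + 0 < low_count r e" if "e \<in> set order6"
      "gadget_available (low_type U0) (high_type U0) (low_rest r) e" for e
    proof (cases "odd r")
      case True
      then have "e \<noteq> (6, False)" using that(2) low low_rest_unavailable by (auto simp: low_rest_def)
      then show ?thesis using True d(3) by (simp add: low_count_def)
    next
      case False
      then obtain i where "r = 2 * i" by (auto elim: evenE)
      then show ?thesis using d(3) by (simp add: low_count_def)
    qed
    show "ext_phase (join n U0 (low_rest r)) = 2 * (Suc r div 2)"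
      using ext_phase_join[OF U0 rest(1)] rest(2) d(2) by (simp add: low_rest_def)
    show "2 * (h0 d + 0) + 1 \<le> 2 * (Suc r div 2)" using d(3) by simp
  qed (use rest(2) in simp_all)
  then obtain H' where H': "ext_step (2 * (Suc r div 2), join n U0 (low_rest r), H1)
      (2 * (Suc r div 2), join n (move U0 d) (low_rest r), H')"
      "agree n (\<lambda>e. (h0(d := Suc (h0 d))) e + 0) (low_count r) H'" by blast
  have "reaches ext_step (l + 0 + 1) (0, {}, \<lambda>_. 0)
      (2 * (Suc r div 2), join n (move U0 d) (low_rest r), H')"
    by (rule reaches_trans[of ext_step, OF reaches_trans[of ext_step, OF H0(1) H1(1)]
        reaches_step[of ext_step, OF H'(1)]])
  moreover have "U \<subseteq> {1..n}"
    unfolding d(5) using d(1) by (intro move_subset[OF U0] available_directions) (auto simp: zbest_def)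
  ultimately show ?case using H'(2) d(5,6) by auto
qed

lemma second_run:
  assumes "(zphase_step n A T \<phi> ^^ l) (0, {}, \<lambda>_. 0) (r, U, h)"
    and start: "agree n (\<lambda>_. Suc K) (\<lambda>d. Suc K + high_count 0 d) H0"
  shows "U \<subseteq> {1..n} \<and> (\<exists>H. reaches ext_step l (2 * K + 4, join n {} {1,2,3,4,5,6}, H0)
    (max (2 * K + 4) (2 * K + 2 + r), join n U (high_rest r), H) \<and>
    agree n (\<lambda>d. h d + Suc K) (\<lambda>d. Suc K + high_count r d) H)"
  using assms(1)
proof (induction l arbitrary: r U h)
  case 0
  have "reaches ext_step 0 (2 * K + 4, join n {} {1,2,3,4,5,6}, H0)
      (max (2 * K + 4) (2 * K + 2 + 0), join n {} (high_rest 0), H0)"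
    by (simp add: high_rest_def reaches_refl)
  moreover have "agree n (\<lambda>d. 0 + Suc K) (\<lambda>d. Suc K + high_count 0 d) H0"
    using start by simp
  ultimately show ?case using 0 by auto
next
  case (Suc l)
  obtain s where "(zphase_step n A T \<phi> ^^ l) (0, {}, \<lambda>_. 0) s"
    "zphase_step n A T \<phi> s (r, U, h)"
    using Suc.prems by (rule relpowp_Suc_E)
  moreover obtain r0 U0 h0 where "s = (r0, U0, h0)" by (cases s)
  ultimately have run: "(zphase_step n A T \<phi> ^^ l) (0, {}, \<lambda>_. 0) (r0, U0, h0)"
    and step: "zphase_step n A T \<phi> (r0, U0, h0) (r, U, h)" by simp_all
  let ?ph = "\<lambda>r. max (2 * K + 4) (2 * K + 2 + r)"
  obtain H1 where U0: "U0 \<subseteq> {1..n}"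
    and H1: "reaches ext_step l (2 * K + 4, join n {} {1,2,3,4,5,6}, H0)
      (?ph r0, join n U0 (high_rest r0), H1)"
    "agree n (\<lambda>d. h0 d + Suc K) (\<lambda>d. Suc K + high_count r0 d) H1"
    using Suc.IH[OF run] by blast
  obtain d where d: "zbest n A T U0 h0 d" "r = \<phi> U0" "2 * h0 d + 1 \<le> r"
    "r = r0 \<or> r = Suc r0 \<and> h0 d = r0 div 2" "U = move U0 d" "h = h0(d := Suc (h0 d))"
    using step by (rule zphase_stepE)
  have low: "low_type U0 \<longleftrightarrow> odd r" and high: "high_type U0 \<longleftrightarrow> odd r \<and> 3 \<le> r"
    using step_phase_types[OF d(1)] d(2) by simp_all
  have "\<exists>H2. reaches ext_step 0 (?ph r0, join n U0 (high_rest r0), H1)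
      (?ph r0, join n U0 (high_rest r), H2) \<and>
      agree n (\<lambda>d. h0 d + Suc K) (\<lambda>d. Suc K + high_count r d) H2"
  proof (cases "r = r0 \<or> r \<le> 2")
    case True
    then have "r = r0 \<or> r0 = 0 \<and> r = 1 \<or> r0 = 1 \<and> r = 2" using d(4) by auto
    then have "high_rest r = high_rest r0" "high_count r = high_count r0"
      by (auto simp: high_rest_def high_count_def)
    then show ?thesis using H1(2) by (intro exI[of _ H1] conjI) (simp_all add: reaches_refl)
  next
    case False
    then have rS: "r = Suc r0" and hd: "h0 d = r0 div 2" and r0_ge: "2 \<le> r0" using d(4) by auto
    \<comment> \<open>The top walk is one round behind, so the old direction has count
      \<open>i + 1\<close>. This is the slack matching the bound 1 in \<open>walk_down_high\<close>
      and \<open>walk_up_high\<close>.\<close>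
    define i where "i = (r0 - 2) div 2"
    define j where "j = Suc K + i"
    have lower: "j + 1 \<le> h0 e + Suc K" if "available n A U0 e" for e
      using zbest_le[OF d(1) that] hd r0_ge by (simp add: i_def j_def)
    show ?thesis
    proof (cases "even r0")
      case True
      then have r0: "r0 = 2 * i + 2" using r0_ge by (simp add: i_def)
      then have \<phi>U: "\<phi> U0 = 2 * i + 3" using d(2) rS by simp
      then have high: "high_type U0" and low: "low_type U0" using high low d(2) by simp_all
      have "\<exists>H2. reaches ext_step 0 (2 * j + 2, join n U0 {1,2,3,4,5,6}, H1)
          (2 * j + 2, join n U0 {2,3,4,5,6}, H2) \<and>
          agree n (\<lambda>d. h0 d + Suc K) (\<lambda>d. j + (if snd d \<or> d = (1, False) then 1 else 0)) H2"
      proof (rule walk_run[OF _ U0 _ _ _ lower])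
        show "walk 0 (low_type U0) (high_type U0) (\<lambda>X. if X = {2,3,4,5,6} then 3 else 2) 1
            (2, {2,3,4,5,6}, \<lambda>d. if snd d \<or> d = (1, False) then 1 else 0)
            (2, {1,2,3,4,5,6}, \<lambda>d. if snd d then 1 else 0) [(1,False)]"
          by (simp only: walk_down_high low high)
        show "agree n (\<lambda>d. h0 d + Suc K) (\<lambda>d. j + (if snd d then 1 else 0)) H1"
          by (rule agree_cong[OF H1(2)]) (simp_all add: high_count_def r0 j_def)
        show "ext_phase (join n U0 Z) = 2 * j + (if Z = {2,3,4,5,6} then 3 else 2)"
          if "Z \<subseteq> {1..6}" "level Z = 0" for Z
          using ext_phase_join[OF U0 that(1)] that(2) high by (simp add: \<phi>U j_def)
      qed simp_all
      then obtain H2 where H2: "reaches ext_step 0 (2 * j + 2, join n U0 {1,2,3,4,5,6}, H1)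
          (2 * j + 2, join n U0 {2,3,4,5,6}, H2)"
        "agree n (\<lambda>d. h0 d + Suc K) (\<lambda>d. j + (if snd d \<or> d = (1, False) then 1 else 0)) H2"
        by blast
      have "agree n (\<lambda>d. h0 d + Suc K) (\<lambda>d. Suc K + high_count r d) H2"
        by (rule agree_cong[OF H2(2)]) (simp_all add: high_count_def rS r0 j_def)
      moreover have "?ph r0 = 2 * j + 2" by (simp add: r0 j_def)
      moreover have "high_rest r0 = {1,2,3,4,5,6}" "high_rest r = {2,3,4,5,6}"
        by (simp_all add: high_rest_def rS r0)
      ultimately show ?thesis using H2(1) by (intro exI[of _ H2] conjI) simp_all
    next
      case False
      then have r0: "r0 = 2 * i + 3" using r0_ge by (auto simp: i_def elim!: oddE)
      then have \<phi>U: "\<phi> U0 = 2 * i + 4" using d(2) rS by simp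
      then have high: "\<not> high_type U0" and low: "\<not> low_type U0" using high low d(2) by simp_all
      have "\<exists>H2. reaches ext_step 0 (2 * j + 3, join n U0 {2,3,4,5,6}, H1)
          (2 * j + 3, join n U0 {1,2,3,4,5,6}, H2) \<and>
          agree n (\<lambda>d. h0 d + Suc K) (\<lambda>d. j + (if snd d then 2 else 1)) H2"
      proof (rule walk_run[OF _ U0 _ _ _ lower])
        show "walk 0 (low_type U0) (high_type U0) (\<lambda>X. if X = {1,2,3,4,5,6} then 4 else 3) 1
            (3, {1,2,3,4,5,6}, \<lambda>d. if snd d then 2 else 1)
            (3, {2,3,4,5,6}, \<lambda>d. if snd d \<or> d = (1, False) then 1 else 0)
            [(2,False), (1,True), (3,False), (2,True), (4,False), (3,True), (5,False),
             (4,True), (6,False), (5,True), (6,True)]"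
          by (simp only: walk_up_high low high)
        show "agree n (\<lambda>d. h0 d + Suc K)
            (\<lambda>d. j + (if snd d \<or> d = (1, False) then 1 else 0)) H1"
          by (rule agree_cong[OF H1(2)]) (simp_all add: high_count_def r0 j_def)
        show "ext_phase (join n U0 Z) = 2 * j + (if Z = {1,2,3,4,5,6} then 4 else 3)"
          if "Z \<subseteq> {1..6}" "level Z = 0" for Z
          using ext_phase_join[OF U0 that(1)] that(2) high by (simp add: \<phi>U j_def)
      qed simp_all
      then obtain H2 where H2: "reaches ext_step 0 (2 * j + 3, join n U0 {2,3,4,5,6}, H1)
          (2 * j + 3, join n U0 {1,2,3,4,5,6}, H2)"
        "agree n (\<lambda>d. h0 d + Suc K) (\<lambda>d. j + (if snd d then 2 else 1)) H2"
        by blast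
      have "agree n (\<lambda>d. h0 d + Suc K) (\<lambda>d. Suc K + high_count r d) H2"
        by (rule agree_cong[OF H2(2)]) (simp_all add: high_count_def rS r0 j_def)
      moreover have "?ph r0 = 2 * j + 3" by (simp add: r0 j_def)
      moreover have "high_rest r0 = {2,3,4,5,6}" "high_rest r = {1,2,3,4,5,6}"
        by (simp_all add: high_rest_def rS r0)
      ultimately show ?thesis using H2(1) by (intro exI[of _ H2] conjI) simp_all
    qed
  qed
  then obtain H2 where H2: "reaches ext_step 0 (?ph r0, join n U0 (high_rest r0), H1)
      (?ph r0, join n U0 (high_rest r), H2)"
      "agree n (\<lambda>d. h0 d + Suc K) (\<lambda>d. Suc K + high_count r d) H2" by blast
  have rest: "high_rest r \<subseteq> {1..6}" "level (high_rest r) = 0"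
    by (simp_all add: high_rest_def level_def)
  have "\<exists>H'. ext_step (?ph r0, join n U0 (high_rest r), H2)
      (?ph r, join n (move U0 d) (high_rest r), H') \<and>
      agree n (\<lambda>e. (h0(d := Suc (h0 d))) e + Suc K) (\<lambda>d. Suc K + high_count r d) H'"
  proof (rule lower_move[OF U0 rest(1) H2(2) d(1)])
    show "h0 d + Suc K < Suc K + high_count r e" if "e \<in> set order6"
      "gadget_available (low_type U0) (high_type U0) (high_rest r) e" for e
      using that high_rest_unavailable[OF that(1)] low high
      by (cases "odd r \<and> 3 \<le> r") (auto simp: high_rest_def)
    show "ext_phase (join n U0 (high_rest r)) = ?ph r"
      using ext_phase_join[OF U0 rest(1)] rest(2) d(2) high by (simp add: high_rest_def)
    show "2 * (h0 d + Suc K) + 1 \<le> ?ph r" using d(3) by simp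
    show "?ph r = ?ph r0 \<or> ?ph r = Suc (?ph r0) \<and> h0 d + Suc K = ?ph r0 div 2"
    proof (cases "r = Suc r0 \<and> 2 \<le> r0")
      case True
      then have "h0 d = r0 div 2" using d(4) by auto
      then show ?thesis using True by (simp add: max_def)
    next
      case False
      then show ?thesis using d(4) by (auto simp: max_def)
    qed
  qed (use rest(2) in simp_all)
  then obtain H' where H': "ext_step (?ph r0, join n U0 (high_rest r), H2)
      (?ph r, join n (move U0 d) (high_rest r), H')"
      "agree n (\<lambda>e. (h0(d := Suc (h0 d))) e + Suc K) (\<lambda>d. Suc K + high_count r d) H'" by blast
  have "reaches ext_step (l + 0 + 1) (2 * K + 4, join n {} {1,2,3,4,5,6}, H0)
      (?ph r, join n (move U0 d) (high_rest r), H')"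
    by (rule reaches_trans[of ext_step, OF reaches_trans[of ext_step, OF H1(1) H2(1)]
        reaches_step[of ext_step, OF H'(1)]])
  moreover have "U \<subseteq> {1..n}"
    unfolding d(5) using d(1) by (intro move_subset[OF U0] available_directions) (auto simp: zbest_def)
  ultimately show ?case using H'(2) d(5,6) by auto
qed

section \<open>Assembling the run in the larger cube\<close>

lemma sink_types: "\<not> low_type {1..n}" "\<not> high_type {1..n}"
  by (simp_all add: low_type_def high_type_def del: One_nat_def)

lemma start_types: "low_type {}" "\<not> high_type {}"
  using n_pos phase_start by (simp_all add: low_type_def high_type_def)

text \<open>The new parameter counts the uses of an old negative direction: \<open>K\<close> in each
  copy of the old run and one in the return.\<close>

lemma extension_ext: "extension (n + 6) ext_out ext_list ext_phase (2 * K + 1)"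
proof
  show "ext_phase {} = 1"
    using ext_phase_join[of "{}" "{}"] phase_start by (simp add: join_def level_def)
  have "{1..6} = {1,2,3,4,5,6::nat}" by auto
  then have "ext_phase (join n {1..n} {1..6}) = max (2 * K + 4) (2 * K + 2 + \<phi> {1..n})"
    using ext_phase_join[of "{1..n}" "{1..6}"] sink_types(2) by (simp add: level_def)
  then show "ext_phase {1..n + 6} = 2 * (2 * K + 1) + 3"
    unfolding join_top using phase_sink by simp
  show "separated (n + 6) ext_out" by (rule ext_separated)
  show "ranked (n + 6) ext_out" by (rule ext_ranked)
  show "distinct ext_list" by (rule ext_list_distinct)
  show "set ext_list = directions (n + 6)" by (rule ext_list_set)
  show "\<not> ext_out {1..n + 6} j" if "j \<in> {1..n + 6}" for j using that by (rule ext_sink)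
  show "n + 6 > 0" by simp
qed

lemma exit_run:
  assumes "agree n h (\<lambda>d. Suc K) H"
  shows "\<exists>H'. reaches ext_step 0 (2 * K + 2, join n {1..n} {}, H)
      (2 * K + 4, join n {1..n} {1,2,3}, H') \<and>
    agree n h (\<lambda>d. Suc K + (if snd d \<and> fst d \<le> 3 then 1 else 0)) H'"
proof -
  have "\<exists>H'. reaches ext_step 0 (2 * Suc K + 0, join n {1..n} {}, H)
      (2 * Suc K + 2, join n {1..n} {1,2,3}, H') \<and>
    agree n h (\<lambda>d. Suc K + (if snd d \<and> fst d \<le> 3 then 1 else 0)) H'"
  proof (rule walk_run)
    show "walk 2 (low_type {1..n}) (high_type {1..n}) (\<lambda>X. if X = {} then 1 else 2) 0
       (2, {1,2,3}, \<lambda>d. if snd d \<and> fst d \<le> 3 then 1 else 0) (0, {}, \<lambda>_. 0)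
       [(1,True), (2,True), (3,True)]"
      by (simp only: walk_exit sink_types)
    show "agree n h (\<lambda>d. Suc K + 0) H" using assms by simp
    show "ext_phase (join n {1..n} Z) = 2 * Suc K + (if Z = {} then 1 else 2)"
      if "Z \<subseteq> {1..6}" "level Z = 2" for Z
      using ext_phase_join[OF order_refl that(1)] that(2) phase_sink by simp
    show "Suc K + 0 \<le> h e" if "available n A {1..n} e" for e
      using that available_sink by blast
  qed simp_all
  moreover have "2 * Suc K + 0 = 2 * K + 2" "2 * Suc K + 2 = 2 * K + 4" by simp_all
  ultimately show ?thesis by (simp only:)
qed

lemma enter_run:
  assumes ag: "agree n (\<lambda>_. Suc K) (\<lambda>d. Suc K + (if snd d \<and> fst d \<le> 3 then 1 else 0)) H"
  shows "\<exists>H'. reaches ext_step 0 (2 * K + 4, join n {} {1,2,3}, H)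
      (2 * K + 4, join n {} {1,2,3,4,5,6}, H') \<and>
    agree n (\<lambda>_. Suc K) (\<lambda>d. Suc K + high_count 0 d) H'"
proof -
  let ?c = "\<lambda>m (d :: direction). if snd d \<and> fst d \<le> m then 1 else 0 :: nat"
  have first: "(4, True) \<in> set order6" "gadget_available True False {1,2,3} (4, True)"
    "\<And>e. e \<in> set order6 \<Longrightarrow> gadget_available True False {1,2,3} e \<Longrightarrow>
      ?c 3 (4, True) < ?c 3 e \<or> ?c 3 (4, True) = ?c 3 e \<and> before order6 (4, True) e"
    using walk_enter_first unfolding walk.simps by blast+
  \<comment> \<open>The move from level 1 to level 0 is treated alone: at \<open>U = {}\<close> all
    old coordinates already point inwards, so only new directions compete.\<close>
  have "\<exists>H1. ext_step (2 * K + 4, join n {} {1,2,3}, H)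
      (2 * K + 4, join n {} (move {1,2,3} (4, True)), H1) \<and>
      agree n (\<lambda>_. Suc K) ((\<lambda>d. Suc K + ?c 3 d)((4, True) := Suc (Suc K + ?c 3 (4, True)))) H1"
  proof (rule gadget_move[OF _ _ ag first(1)])
    show "gadget_available (low_type {}) (high_type {}) {1,2,3} (4, True)"
      using first(2) start_types by simp
    show "Suc K + ?c 3 (4, True) < Suc K + ?c 3 e \<or>
        Suc K + ?c 3 (4, True) = Suc K + ?c 3 e \<and> before order6 (4, True) e"
      if "e \<in> set order6" "gadget_available (low_type {}) (high_type {}) {1,2,3} e" for e
      using first(3)[OF that(1)] that(2) start_types by simp
    show "ext_phase (join n {} {1,2,3}) = 2 * K + 4"
      using ext_phase_join[of "{}" "{1,2,3}"] by (simp add: level_def)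
  qed (simp_all add: level_def)
  then obtain H1 where step: "ext_step (2 * K + 4, join n {} {1,2,3}, H)
      (2 * K + 4, join n {} (move {1,2,3} (4, True)), H1)"
    and ag1: "agree n (\<lambda>_. Suc K)
      ((\<lambda>d. Suc K + ?c 3 d)((4, True) := Suc (Suc K + ?c 3 (4, True)))) H1" by blast
  have mv: "move {1,2,3} (4, True) = {1,2,3,4}" by (auto simp: move_def)
  have "\<exists>H'. reaches ext_step 0 (2 * Suc K + 2, join n {} {1,2,3,4}, H1)
      (2 * Suc K + 2, join n {} {1,2,3,4,5,6}, H') \<and>
      agree n (\<lambda>_. Suc K) (\<lambda>d. Suc K + (if snd d then 1 else 0)) H'"
  proof (rule walk_run)
    show "walk 0 (low_type {}) (high_type {}) (\<lambda>X. 2) 0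
       (2, {1,2,3,4,5,6}, \<lambda>d. if snd d then 1 else 0) (2, {1,2,3,4}, ?c 4) [(5,True), (6,True)]"
      by (simp only: walk_enter start_types)
    show "agree n (\<lambda>_. Suc K) (\<lambda>d. Suc K + ?c 4 d) H1"
    proof (rule agree_cong[OF ag1])
      fix d assume "d \<in> set order6"
      show "((\<lambda>d. Suc K + ?c 3 d)((4, True) := Suc (Suc K + ?c 3 (4, True)))) d = Suc K + ?c 4 d"
        by (cases d) auto
    qed simp
    show "ext_phase (join n {} Z) = 2 * Suc K + 2" if "Z \<subseteq> {1..6}" "level Z = 0" for Z
      using ext_phase_join[OF empty_subsetI that(1)] that(2) phase_start start_types by simp
  qed simp_all
  then obtain H' where H': "reaches ext_step 0 (2 * Suc K + 2, join n {} {1,2,3,4}, H1)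
      (2 * Suc K + 2, join n {} {1,2,3,4,5,6}, H')"
    "agree n (\<lambda>_. Suc K) (\<lambda>d. Suc K + (if snd d then 1 else 0)) H'" by blast
  have ph: "2 * Suc K + 2 = 2 * K + 4" by simp
  have "reaches ext_step 0 (2 * K + 4, join n {} {1,2,3}, H)
      (2 * K + 4, join n {} {1,2,3,4,5,6}, H')"
    by (rule reaches_step_trans[of ext_step, OF step]) (use H'(1) in \<open>simp only: mv ph\<close>)
  moreover have "agree n (\<lambda>_. Suc K) (\<lambda>d. Suc K + high_count 0 d) H'"
    by (rule agree_cong[OF H'(2)]) (simp_all add: high_count_def)
  ultimately show ?thesis by blast
qed

text \<open>Joins first copy, exit, return, ascent and second copy. Only the copies contribute to
  the length bound, which gives the factor two.\<close>

lemma ext_run: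
  assumes run: "(zphase_step n A T \<phi> ^^ l) (0, {}, \<lambda>_. 0) (2 * K + 2, {1..n}, h)"
    and h: "\<And>c. c \<in> {1..n} \<Longrightarrow> h (c, True) = Suc K \<and> h (c, False) = K"
  shows "\<exists>H. reaches ext_step (2 * l) (0, {}, \<lambda>_. 0) (2 * (2 * K + 1) + 2, {1..n + 6}, H) \<and>
    (\<forall>c \<in> {1..n + 6}. H (c, True) = Suc (2 * K + 1) \<and> H (c, False) = 2 * K + 1)"
proof -
  let ?g = "\<lambda>d. Suc K + (if snd d \<and> fst d \<le> 3 then 1 else 0)"
  have low: "low_rest (2 * K + 2) = {}" "low_count (2 * K + 2) = (\<lambda>d. Suc K)"
    "2 * (Suc (2 * K + 2) div 2) = 2 * K + 2"
    by (simp_all add: low_rest_def low_count_def fun_eq_iff)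
  obtain H1 where H1: "reaches ext_step l (0, {}, \<lambda>_. 0) (2 * K + 2, join n {1..n} {}, H1)"
    "agree n h (\<lambda>d. Suc K) H1"
    using first_run[OF run] unfolding low by blast
  obtain H2 where H2: "reaches ext_step 0 (2 * K + 2, join n {1..n} {}, H1)
      (2 * K + 4, join n {1..n} {1,2,3}, H2)" "agree n h ?g H2"
    using exit_run[OF H1(2)] by blast
  have "\<exists>H3. reaches ext_step 0 (2 * K + 4, join n {1..n} {1,2,3}, H2)
      (2 * K + 4, join n {} {1,2,3}, H3) \<and> agree n (\<lambda>_. Suc K) ?g H3"
    by (rule return_run[OF _ _ _ H2(2)]) (use h in \<open>auto simp: level_def\<close>)
  then obtain H3 where H3: "reaches ext_step 0 (2 * K + 4, join n {1..n} {1,2,3}, H2)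
      (2 * K + 4, join n {} {1,2,3}, H3)" "agree n (\<lambda>_. Suc K) ?g H3" by blast
  obtain H4 where H4: "reaches ext_step 0 (2 * K + 4, join n {} {1,2,3}, H3)
      (2 * K + 4, join n {} {1,2,3,4,5,6}, H4)"
    "agree n (\<lambda>_. Suc K) (\<lambda>d. Suc K + high_count 0 d) H4"
    using enter_run[OF H3(2)] by blast
  obtain H5 where H5: "reaches ext_step l (2 * K + 4, join n {} {1,2,3,4,5,6}, H4)
      (max (2 * K + 4) (2 * K + 2 + (2 * K + 2)), join n {1..n} (high_rest (2 * K + 2)), H5)"
    "agree n (\<lambda>d. h d + Suc K) (\<lambda>d. Suc K + high_count (2 * K + 2) d) H5"
    using second_run[OF run H4(2)] by blast
  have "{1..6} = {1,2,3,4,5,6::nat}" by auto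
  then have top: "join n {1..n} (high_rest (2 * K + 2)) = {1..n + 6}"
    unfolding join_top by (simp add: high_rest_def)
  have ph: "max (2 * K + 4) (2 * K + 2 + (2 * K + 2)) = 2 * (2 * K + 1) + 2" by simp
  have "reaches ext_step (l + 0 + 0 + 0 + l) (0, {}, \<lambda>_. 0) (2 * (2 * K + 1) + 2, {1..n + 6}, H5)"
    using reaches_trans[of ext_step, OF reaches_trans[of ext_step, OF reaches_trans[of ext_step,
      OF reaches_trans[of ext_step, OF H1(1) H2(1)] H3(1)] H4(1)] H5(1)]
    unfolding top ph .
  moreover have "H5 (c, True) = Suc (2 * K + 1) \<and> H5 (c, False) = 2 * K + 1"
    if c: "c \<in> {1..n + 6}" for c
  proof (cases "c \<le> n")
    case True
    then have "(c, b) \<in> directions n" for b using c by (simp add: directions_def)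
    then have "H5 (c, b) = h (c, b) + Suc K" for b using H5(2) by (simp add: agree_def)
    then show ?thesis using h[of c] True c by simp
  next
    case False
    then have i: "c - n \<in> {1..6}" "n + (c - n) = c" using c by auto
    then have "(c - n, b) \<in> set order6" for b by (auto simp: mem_order6)
    then have "H5 (lift n (c - n, b)) = Suc K + high_count (2 * K + 2) (c - n, b)" for b
      using H5(2) by (simp add: agree_def)
    then have "H5 (c, b) = Suc K + high_count (2 * K + 2) (c - n, b)" for b
      using i(2) by (simp add: lift_def)
    then show ?thesis by (simp add: high_count_def)
  qed
  ultimately show ?thesis by (intro exI[of _ H5] conjI ballI) (simp_all add: mult_2)
qed

end

section \<open>The base case\<close>

text \<open>With \<open>K = 0\<close> there is a single round of upward moves: phase 1 is the first
  move, phase 2 the remaining ones, and the sink gets \<open>2 * 0 + 3\<close>.\<close>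

definition base_phase :: "nat set \<Rightarrow> nat" where
  "base_phase w = (if w = {} then 1 else if w = {1..6} then 3 else 2)"

lemma before_order6:
  assumes "1 \<le> k" "k \<le> i" "i \<le> 6"
  shows "before order6 (k, True) (i, True)"
proof -
  have "\<forall>k \<in> {1,2,3,4,5,6}. \<forall>i \<in> {1,2,3,4,5,6}. k \<le> i \<longrightarrow> before order6 (k, True) (i, True)"
    by code_simp
  moreover have "k \<in> {1,2,3,4,5,6}" "i \<in> {1,2,3,4,5,6}" using assms by auto
  ultimately show ?thesis using assms(2) by blast
qed

lemma base_extension: "extension 6 (\<lambda>w j. j \<notin> w) order6 base_phase 0"
proof
  show "separated 6 (\<lambda>w j. j \<notin> w)"
    unfolding separated_def
  proof (intro ballI impI)
    fix u v :: "nat set" assume "u \<noteq> v"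
    then obtain j where "j \<in> sym_diff u v" by (auto simp: sym_diff_def)
    then show "\<exists>j \<in> sym_diff u v. (j \<notin> u) \<noteq> (j \<notin> v)"
      by (intro bexI[of _ j]) (auto simp: sym_diff_iff)
  qed
  show "ranked 6 (\<lambda>w j. j \<notin> w)"
    unfolding ranked_def
  proof (intro exI[of _ "\<lambda>w. card ({1..6} - w)"] ballI impI)
    fix u :: "nat set" and j :: nat assume "j \<in> {1..6}" "j \<notin> u"
    then have "{1..6} - sym_diff u {j} = ({1..6} - u) - {j}" "j \<in> {1..6} - u"
      unfolding sym_diff_def by blast+
    then show "card ({1..6} - sym_diff u {j}) < card ({1..6} - u)"
      using card_Diff1_less[of "{1..6} - u" j] by (simp only: finite_Diff finite_atLeastAtMost)
  qed
  show "distinct order6" by (simp add: order6_def)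
  have "{1..6} = {1,2,3,4,5,6::nat}" by auto
  then show "set order6 = directions 6"
    by (intro set_eqI) (simp only: directions_def mem_order6 mem_Times_iff UNIV_I simp_thms)
  show "base_phase {} = 1" "base_phase {1..6} = 2 * 0 + 3" by (simp_all add: base_phase_def)
  show "\<not> j \<notin> {1..6}" if "j \<in> {1..6}" for j :: nat using that by blast
  show "(0 :: nat) < 6" by simp
qed

lemma base_step:
  assumes k: "k < 6"
  shows "zphase_step 6 (\<lambda>w j. j \<notin> w) order6 base_phase
    (min k 2, {1..k}, \<lambda>d. if snd d \<and> fst d \<in> {1..k} then 1 else 0)
    (min (Suc k) 2, {1..Suc k}, \<lambda>d. if snd d \<and> fst d \<in> {1..Suc k} then 1 else 0)"
proof -
  let ?h = "\<lambda>d :: direction. if snd d \<and> fst d \<in> {1..k} then 1 else 0 :: nat"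
  let ?d = "(Suc k, True)"
  have best: "zbest 6 (\<lambda>w j. j \<notin> w) order6 {1..k} ?h ?d"
    unfolding zbest_def
  proof (intro conjI allI impI)
    show "available 6 (\<lambda>w j. j \<notin> w) {1..k} ?d" using k by (simp add: available_def)
    fix e assume "available 6 (\<lambda>w j. j \<notin> w) {1..k} e"
    then obtain i where e: "e = (i, True)" "i \<in> {Suc k..6}"
      by (cases e) (auto simp: available_def)
    then have "before order6 ?d e" using before_order6[of "Suc k" i] by simp
    then show "?h ?d < ?h e \<or> ?h ?d = ?h e \<and> before order6 ?d e" using e by simp
  qed
  have "{1..k} \<noteq> {1..6}" using k by simp
  then have ph: "base_phase {1..k} = min (Suc k) 2"
    by (cases "k = 0") (simp_all add: base_phase_def)
  have "zphase_step 6 (\<lambda>w j. j \<notin> w) order6 base_phase (min k 2, {1..k}, ?h)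
      (min (Suc k) 2, move {1..k} ?d, ?h(?d := Suc (?h ?d)))"
    by (rule zphase_stepI[where \<phi> = base_phase, OF best ph]) auto
  moreover have "move {1..k} ?d = {1..Suc k}" by (auto simp: move_def)
  moreover have "?h(?d := Suc (?h ?d)) = (\<lambda>d. if snd d \<and> fst d \<in> {1..Suc k} then 1 else 0)"
    by (auto simp: fun_eq_iff)
  ultimately show ?thesis by (simp only:)
qed

lemma base_run:
  "k \<le> 6 \<Longrightarrow> (zphase_step 6 (\<lambda>w j. j \<notin> w) order6 base_phase ^^ k) (0, {}, \<lambda>_. 0)
    (min k 2, {1..k}, \<lambda>d. if snd d \<and> fst d \<in> {1..k} then 1 else 0)"
proof (induction k)
  case (Suc k)
  then show ?case using base_step[of k] by auto
qed simp

text \<open>The base run has 6 steps, at least the required 2, and every six further dimensions at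
  least double the length.\<close>

lemma zadeh_exponential:
  "\<exists>A T \<phi> K l h. extension (6 * Suc m) A T \<phi> K \<and> 2 ^ Suc m \<le> l \<and>
     (zphase_step (6 * Suc m) A T \<phi> ^^ l) (0, {}, \<lambda>_. 0) (2 * K + 2, {1..6 * Suc m}, h) \<and>
     (\<forall>c \<in> {1..6 * Suc m}. h (c, True) = Suc K \<and> h (c, False) = K)"
proof (induction m)
  case 0
  let ?h = "\<lambda>d :: direction. if snd d \<and> fst d \<in> {1..6} then 1 else 0 :: nat"
  have six: "6 * Suc 0 = (6 :: nat)" by simp
  have "min 6 2 = 2 * 0 + (2 :: nat)" by simp
  then have run: "(zphase_step 6 (\<lambda>w j. j \<notin> w) order6 base_phase ^^ 6) (0, {}, \<lambda>_. 0)
      (2 * 0 + 2, {1..6}, ?h)"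
    using base_run[OF order_refl] by (simp only:)
  show ?case
    unfolding six
  proof (rule exI[of _ "\<lambda>w j. j \<notin> w"], rule exI[of _ order6], rule exI[of _ base_phase],
      rule exI[of _ 0], rule exI[of _ 6], rule exI[of _ ?h], intro conjI ballI)
    show "extension 6 (\<lambda>w j. j \<notin> w) order6 base_phase 0" by (rule base_extension)
  qed (use run in simp_all)
next
  case (Suc m)
  then obtain A T \<phi> K l h where ext: "extension (6 * Suc m) A T \<phi> K" and l: "2 ^ Suc m \<le> l"
    and run: "(zphase_step (6 * Suc m) A T \<phi> ^^ l) (0, {}, \<lambda>_. 0) (2 * K + 2, {1..6 * Suc m}, h)"
    and h: "\<forall>c \<in> {1..6 * Suc m}. h (c, True) = Suc K \<and> h (c, False) = K" by blast
  interpret extension "6 * Suc m" A T \<phi> K by (rule ext)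
  have n: "6 * Suc m + 6 = 6 * Suc (Suc m)" by simp
  obtain H l' where "2 * l \<le> l'"
    and run': "(ext_step ^^ l') (0, {}, \<lambda>_. 0) (2 * (2 * K + 1) + 2, {1..6 * Suc m + 6}, H)"
    and H: "\<forall>c \<in> {1..6 * Suc m + 6}. H (c, True) = Suc (2 * K + 1) \<and> H (c, False) = 2 * K + 1"
    using ext_run[OF run] h unfolding reaches_def by blast
  moreover have "2 ^ Suc (Suc m) \<le> 2 * l" using l by simp
  ultimately have "2 ^ Suc (Suc m) \<le> l'" by simp
  then show ?case
    by (intro exI conjI) (use extension_ext run' H in \<open>simp_all only: n\<close>)
qed

theorem theorem8:
  fixes n :: nat
  assumes "n > 0" and "6 dvd n"
  shows "\<exists>out v0 T. is_AUSO n out \<and> v0 \<in> vertices n \<and>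
           distinct T \<and> set T = directions n \<and>
           (\<forall>k < 2 ^ (n div 6). \<not> is_global_sink n out (fst (zadeh_run n out T v0 k)))"
proof -
  \<comment> \<open>Since \<open>n\<close> is a positive multiple of 6, the truncated subtraction is
    exact and \<open>n = 6 * Suc m\<close>.\<close>
  define m where "m = n div 6 - 1"
  have n: "n = 6 * Suc m" and div: "n div 6 = Suc m" using assms by (auto simp: m_def)
  obtain A T \<phi> K l h where ext: "extension n A T \<phi> K" and l: "2 ^ Suc m \<le> l"
    and run: "(zphase_step n A T \<phi> ^^ l) (0, {}, \<lambda>_. 0) (2 * K + 2, {1..n}, h)"
    using zadeh_exponential[of m] unfolding n by blast
  interpret extension n A T \<phi> K by (rule ext)
  have "is_AUSO n A"
    using separated_imp_USO[OF A_separated] ranked_imp_acyclic[OF A_ranked]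
    by (simp add: is_AUSO_def)
  moreover have "{} \<in> vertices n" by (simp add: vertices_def)
  moreover have "\<not> is_global_sink n A (fst (zadeh_run n A T {} k))" if "k < 2 ^ (n div 6)" for k
    using zphase_run_not_sink[OF run _ T_set] that l div by simp
  ultimately show ?thesis using T_distinct T_set by blast
qed

end
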